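(* For any $\mathbf{w}_0,\mathbf{w}_1\in\mathbb{R}^D$ and any $\epsilon>0$ there exists $\delta>0$ such that $$d_{\mathcal{P}}([\mathbf{w}_0],[\mathbf{w}_1])<\delta\quad\Longrightarrow\quad d_{f^*H}(\mathbf{w}_0,\mathbf{w}_1)<\epsilon,$$ $$d_{f^*H}(\mathbf{w}_0,\mathbf{w}_1)<\delta\quad\Longrightarrow\quad d_{\mathcal{P}}([\mathbf{w}_0],[\mathbf{w}_1])<\epsilon,$$ where $d_{f^*H}$ is the geodesic pseudo-distance on $\mathbb{R}^D$ induced by the pullback pseudo-metric $\mathrm{GGN}_{\mathbf{w}}$ and $d_{\mathcal{P}}$ is the quotient distance on $\mathcal{P}=\mathbb{R}^D/\!\sim$ inherited from the Euclidean distance.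
   Context: Setting. Let $f:\mathbb{R}^D\times\mathbb{R}^I\to\mathbb{R}^O$, $(\mathbf{w},\mathbf{x})\mapsto f(\mathbf{w},\mathbf{x})$, be a function (neural network) continuously differentiable in $\mathbf{w}$, and let $\mathcal{X}=\{\mathbf{x}_1,\ldots,\mathbf{x}_N\}\subset\mathbb{R}^I$ be a finite set of points. Let $\mathbf{J}_{\mathbf{w}}(\mathbf{x})=\partial_{\mathbf{w}}f(\mathbf{w},\mathbf{x})\in\mathbb{R}^{O\times D}$ and let $\mathbf{J}_{\mathbf{w}}\in\mathbb{R}^{NO\times D}$ be the vertical stacking of $\mathbf{J}_{\mathbf{w}}(\mathbf{x}_1),\ldots,\mathbf{J}_{\mathbf{w}}(\mathbf{x}_N)$. Let $p(\mathbf{y}\mid\mathbf{z})$, $\mathbf{z}\in\mathbb{R}^O$, be a likelihood whose negative log-Hessian $-\partial^2_{\mathbf{z}}\log p(\mathbf{y}\mid\mathbf{z})\in\mathbb{R}^{O\times O}$ does not depend on $\mathbf{y}$, is continuous in $\mathbf{z}$, and is positive definite. Let $\mathbf{H}_{\mathbf{w}}(\mathbf{x})$ be this matrix evaluated at $\mathbf{z}=f(\mathbf{w},\mathbf{x})$, and let $\mathbf{H}_{\mathbf{w}}\in\mathbb{R}^{NO\times NO}$ be the block-diagonal matrix with blocks $\mathbf{H}_{\mathbf{w}}(\mathbf{x}_1),\ldots,\mathbf{H}_{\mathbf{w}}(\mathbf{x}_N)$. Define $\mathrm{GGN}_{\mathbf{w}}=\mathbf{J}_{\mathbf{w}}^\top\mathbf{H}_{\mathbf{w}}\mathbf{J}_{\mathbf{w}}\in\mathbb{R}^{D\times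 D}$ and $\mathrm{NTK}_{\mathbf{w}}=\mathbf{H}_{\mathbf{w}}^{1/2}\mathbf{J}_{\mathbf{w}}\mathbf{J}_{\mathbf{w}}^\top\mathbf{H}_{\mathbf{w}}^{1/2}\in\mathbb{R}^{NO\times NO}$. Standing assumptions. There are constants $0<l\le L$ such that $l\le\|\mathrm{NTK}_{\mathbf{w}}v\|/\|v\|\le L$ for all nonzero $v\in\mathbb{R}^{NO}$ and all $\mathbf{w}\in\mathbb{R}^D$; and for every $\mathbf{x}\in\mathcal{X}$ the map $\mathbf{w}\mapsto\mathbf{J}_{\mathbf{w}}(\mathbf{x})$ is Lipschitz. Pseudo-distance. The pullback pseudo-metric at $\mathbf{w}$ is $(f^*H)_{\mathbf{w}}=\mathrm{GGN}_{\mathbf{w}}$, and $$d_{f^*H}(\mathbf{w}_0,\mathbf{w}_1)=\inf_\gamma\int_0^1\sqrt{\gamma'(t)^\top\,\mathrm{GGN}_{\gamma(t)}\,\gamma'(t)}\,dt,$$ the infimum being over smoothly (continuously) differentiable curves $\gamma:[0,1]\to\mathbb{R}^D$ with $\gamma(0)=\mathbf{w}_0$, $\gamma(1)=\mathbf{w}_1$. Quotient. Write $\mathbf{w}\sim\mathbf{w}'$ if there is a continuous, piecewise differentiable $\gamma:[0,1]\to\mathbb{R}^D$ with $\gamma(0)=\mathbf{w}$, $\gamma(1)=\mathbf{w}'$ and $f(\gamma(t),\mathbf{x})=f(\mathbf{w},\mathbf{x})$ for all $t\in[0,1]$ and $\mathbf{x}\in\mathcal{X}$. This is an equivalence relation;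 $[\mathbf{w}]$ denotes the class of $\mathbf{w}$ and $\mathcal{P}=\mathbb{R}^D/\!\sim$. The quotient distance is $$d_{\mathcal{P}}([\mathbf{w}],[\mathbf{w}'])=\inf\Big\{\sum_{i=1}^n\|p_i-q_i\|\Big\},$$ the infimum being over all $n\ge1$ and all finite sequences $p_1,\ldots,p_n$ and $q_1,\ldots,q_n$ in $\mathbb{R}^D$ with $[\mathbf{w}]=[p_1]$, $[p_{i+1}]=[q_i]$ for $1\le i\le n-1$, and $[q_n]=[\mathbf{w}']$; here $\|\cdot\|$ is the Euclidean norm. *)

theory Defs
  imports "HOL-Analysis.Analysis"
begin

definition pos_semidef :: "real^'n^'n \<Rightarrow> bool" where
  "pos_semidef A \<longleftrightarrow> transpose A = A \<and> (\<forall>v. 0 \<le> v \<bullet> (A *v v))"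

definition pos_def :: "real^'n^'n \<Rightarrow> bool" where
  "pos_def A \<longleftrightarrow> transpose A = A \<and> (\<forall>v. v \<noteq> 0 \<longrightarrow> 0 < v \<bullet> (A *v v))"

text \<open>The unique positive semidefinite square root; meaningful for positive semidefinite \<open>A\<close>.\<close>

definition matrix_sqrt :: "real^'n^'n \<Rightarrow> real^'n^'n" where
  "matrix_sqrt A = (THE B. pos_semidef B \<and> B ** B = A)"

text \<open>\<open>phi\<close> is twice differentiable everywhere and \<open>A z\<close> is its Hessian, i.e. the Jacobian
  matrix of its gradient field, at \<open>z\<close>.\<close>

definition has_hessian :: "(real^'o \<Rightarrow> real) \<Rightarrow> (real^'o \<Rightarrow> real^'o^'o) \<Rightarrow> bool" where
  "has_hessian phi A \<longleftrightarrow>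
     (\<exists>g. \<forall>z. GDERIV phi z :> g z \<and> (g has_derivative (\<lambda>h. A z *v h)) (at z))"

text \<open>\<open>p y z\<close> stands for $p(y \mid z)$: a probability density in \<open>y\<close> with respect to a reference
  measure \<open>\<nu>\<close> (counting measure for discrete, Lebesgue measure for continuous outcomes).
  Positivity makes $\log p(y \mid z)$ meaningful for all outcomes.\<close>

definition is_likelihood :: "'y measure \<Rightarrow> ('y \<Rightarrow> real^'o \<Rightarrow> real) \<Rightarrow> bool" where
  "is_likelihood \<nu> p \<longleftrightarrow>
     (\<forall>z. (\<forall>y\<in>space \<nu>. 0 < p y z) \<and> has_bochner_integral \<nu> (\<lambda>y. p y z) 1)"

definition Jac :: "(real^'d \<Rightarrow> real^'i \<Rightarrow> real^'o) \<Rightarrow> real^'d \<Rightarrow> real^'i \<Rightarrow> real^'d^'o" where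
  "Jac f w x = jacobian (\<lambda>v. f v x) (at w)"

text \<open>The points $x_1, \ldots, x_N$ are given as \<open>X :: 'n \<Rightarrow> real^'i\<close>, with \<open>N = CARD('n)\<close>.
  Row \<open>(k, a)\<close> of a stacked matrix is output coordinate \<open>a\<close> at the point \<open>X k\<close>, so that
  $\mathbb{R}^{NO}$ is \<open>real^('n \<times> 'o)\<close>. The Hessian of $-\log p(y \mid \cdot)$ enters as \<open>H :: real^'o \<Rightarrow> real^'o^'o\<close>,
  a function of the network output, the same for every \<open>y\<close>.\<close>

definition J_stack :: "(real^'d \<Rightarrow> real^'i \<Rightarrow> real^'o) \<Rightarrow> ('n \<Rightarrow> real^'i) \<Rightarrow> real^'d
    \<Rightarrow> real^'d^('n::finite \<times> 'o::finite)" where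
  "J_stack f X w = (\<chi> r. Jac f w (X (fst r)) $ snd r)"

definition H_block :: "(real^'d \<Rightarrow> real^'i \<Rightarrow> real^'o) \<Rightarrow> (real^'o \<Rightarrow> real^'o^'o) \<Rightarrow> ('n \<Rightarrow> real^'i)
    \<Rightarrow> real^'d \<Rightarrow> real^('n::finite \<times> 'o::finite)^('n \<times> 'o)" where
  "H_block f H X w =
     (\<chi> r s. if fst r = fst s then H (f w (X (fst r))) $ snd r $ snd s else 0)"

definition GGN :: "(real^'d \<Rightarrow> real^'i \<Rightarrow> real^'o) \<Rightarrow> (real^'o \<Rightarrow> real^'o^'o)
    \<Rightarrow> ('n::finite \<Rightarrow> real^'i) \<Rightarrow> real^'d \<Rightarrow> real^'d^'d" where
  "GGN f H X w = transpose (J_stack f X w) ** H_block f H X w ** J_stack f X w"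

definition NTK :: "(real^'d \<Rightarrow> real^'i \<Rightarrow> real^'o) \<Rightarrow> (real^'o \<Rightarrow> real^'o^'o)
    \<Rightarrow> ('n \<Rightarrow> real^'i) \<Rightarrow> real^'d \<Rightarrow> real^('n::finite \<times> 'o::finite)^('n \<times> 'o)" where
  "NTK f H X w = matrix_sqrt (H_block f H X w) ** J_stack f X w **
     transpose (J_stack f X w) ** matrix_sqrt (H_block f H X w)"

text \<open>Geodesic pseudo-distance of a pseudo-metric \<open>G\<close> on $\mathbb{R}^D$. The curves are
  continuously differentiable on the closed unit interval, with one-sided derivatives at the
  endpoints.\<close>

definition geod_dist :: "(real^'d \<Rightarrow> real^'d^'d) \<Rightarrow> real^'d \<Rightarrow> real^'d \<Rightarrow> real" where
  "geod_dist G w0 w1 = Inf {integral {0..1} (\<lambda>t. sqrt (\<gamma>' t \<bullet> (G (\<gamma> t) *v \<gamma>' t))) | \<gamma> \<gamma>'.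
     (\<forall>t\<in>{0..1}. (\<gamma> has_vector_derivative \<gamma>' t) (at t within {0..1})) \<and>
     continuous_on {0..1} \<gamma>' \<and> \<gamma> 0 = w0 \<and> \<gamma> 1 = w1}"

definition fiber_rel :: "(real^'d \<Rightarrow> real^'i \<Rightarrow> real^'o) \<Rightarrow> ('n \<Rightarrow> real^'i)
    \<Rightarrow> ((real^'d) \<times> (real^'d)) set" where
  "fiber_rel f X = {(w, w'). \<exists>\<gamma>. \<gamma> piecewise_differentiable_on {0..1::real} \<and>
     \<gamma> 0 = w \<and> \<gamma> 1 = w' \<and> (\<forall>t\<in>{0..1}. \<forall>k. f (\<gamma> t) (X k) = f w (X k))}"

text \<open>The distance that a relation \<open>R\<close> induces on its quotient \<open>UNIV // R\<close>; the class of \<open>w\<close>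
  is \<open>R `` {w}\<close>.\<close>

definition quot_dist :: "('a::real_normed_vector \<times> 'a) set \<Rightarrow> 'a set \<Rightarrow> 'a set \<Rightarrow> real" where
  "quot_dist R A B = Inf {\<Sum>i=1..n. norm (p i - q i) | (n::nat) p q.
     1 \<le> n \<and> A = R `` {p 1} \<and> (\<forall>i\<in>{1..<n}. R `` {p (i + 1)} = R `` {q i}) \<and> R `` {q n} = B}"

end

theory Submission
  imports Defs
begin

text \<open>With \<open>D\<close> the quotient distance and \<open>d\<close> the geodesic pseudo-distance, one has
  \<open>sqrt l * D \<le> d \<le> sqrt L * D\<close>. Put \<open>M = sqrt H J\<close>, so that \<open>NTK = M M\<^sup>T\<close> and
  \<open>GGN = M\<^sup>T M\<close>: the pseudo-metric vanishes on \<open>ker J\<close>, the tangent space of the fibre of the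
  stacked network output, and lies between \<open>sqrt l\<close> and \<open>sqrt L\<close> times the Euclidean norm on its
  orthogonal complement.

  Upper bound: a segment of length \<open>r\<close> costs at most \<open>sqrt L * r\<close>, and points of one class have
  \<open>d = 0\<close>, because the fibres are locally connected by \<open>C\<^sup>1\<close> curves, which have length zero.

  Lower bound: near each parameter \<open>s\<close> of a curve \<open>\<gamma>\<close>, follow in the fibre through \<open>\<gamma> s\<close> a curve
  whose velocity is the vertical part of \<open>\<gamma>' s\<close>; it stays in the class of \<open>\<gamma> s\<close>, and its distance
  from \<open>\<gamma>\<close> is governed by the horizontal part of \<open>\<gamma>' s\<close>. This bounds the growth of \<open>D\<close> along \<open>\<gamma>\<close>
  to first order by the speed of \<open>\<gamma>\<close>, and integrating gives the bound by the length, without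
  lifting \<open>\<gamma>\<close> globally.\<close>

section \<open>Square roots of positive definite matrices\<close>

text \<open>Writing \<open>B = 1 - Y\<close> turns \<open>B B = 1 - E\<close> into the fixed point
  equation \<open>Y = (E + Y Y) / 2\<close>, which the Banach fixed point theorem solves among the
  self-adjoint operators in a ball of radius less than 1. That radius also makes
  \<open>1 - Y\<close> coercive.\<close>

lemma blinfun_square_root_near_id:
  fixes E :: "'a::euclidean_space \<Rightarrow>\<^sub>L 'a"
  assumes q: "norm E < 1" and sym: "\<And>u v. E u \<bullet> v = u \<bullet> E v"
  obtains B :: "'a \<Rightarrow>\<^sub>L 'a" and c where
    "B o\<^sub>L B = id_blinfun - E" "\<And>u v. B u \<bullet> v = u \<bullet> B v"
    "c > 0" "\<And>v. c * (norm v)\<^sup>2 \<le> v \<bullet> B v"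
proof -
  \<comment> \<open>The smaller solution of \<open>r = (norm E + r^2) / 2\<close>, the scalar form
    of the fixed point equation. The ball of this radius is mapped into itself, and \<open>r\<close>
    is also the contraction constant.\<close>
  define r where "r = 1 - sqrt (1 - norm E)"
  have r: "0 \<le> r" "r < 1" using q by (auto simp: r_def)
  have rr: "(norm E + r * r) / 2 = r"
  proof -
    have "(1 - r)\<^sup>2 = 1 - norm E" using q by (simp add: r_def)
    then show ?thesis by (simp add: power2_eq_square algebra_simps)
  qed
  define S where "S = cball 0 r \<inter> {Y::'a \<Rightarrow>\<^sub>L 'a. \<forall>u v. Y u \<bullet> v = u \<bullet> Y v}"
  define T where "T Y = (1/2) *\<^sub>R (E + (Y o\<^sub>L Y))" for Y :: "'a \<Rightarrow>\<^sub>L 'a"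
  have "closed {Y::'a \<Rightarrow>\<^sub>L 'a. \<forall>u v. Y u \<bullet> v = u \<bullet> Y v}"
    by (intro closed_Collect_all closed_Collect_eq continuous_intros)
  then have "complete S" unfolding S_def by (intro closed_Int complete_eq_closed[THEN iffD2]) auto
  moreover have "0 \<in> S" using r by (simp add: S_def)
  then have "S \<noteq> {}" by blast
  moreover have "T ` S \<subseteq> S"
  proof safe
    fix Y assume Y: "Y \<in> S"
    have "norm (T Y) \<le> (norm E + norm Y * norm Y) / 2"
      using norm_triangle_ineq[of E "Y o\<^sub>L Y"] norm_blinfun_compose[of Y Y] by (simp add: T_def)
    also have "\<dots> \<le> (norm E + r * r) / 2"
      using Y r by (intro divide_right_mono add_left_mono mult_mono) (auto simp: S_def)
    finally have "norm (T Y) \<le> r" using rr by simp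
    moreover have "T Y u \<bullet> v = u \<bullet> T Y v" for u v
      using Y sym by (simp add: T_def S_def blinfun.bilinear_simps inner_simps)
    ultimately show "T Y \<in> S" by (auto simp: S_def)
  qed
  moreover have "dist (T Y) (T Z) \<le> r * dist Y Z" if "Y \<in> S" "Z \<in> S" for Y Z
  proof -
    \<comment> \<open>\<open>Y Y - Z Z = Y (Y - Z) + (Y - Z) Z\<close> holds without
      commutativity.\<close>
    have "T Y - T Z = (1/2) *\<^sub>R ((Y o\<^sub>L (Y - Z)) + ((Y - Z) o\<^sub>L Z))"
      by (rule blinfun_eqI) (simp add: T_def blinfun.bilinear_simps algebra_simps)
    then have "norm (T Y - T Z) \<le> (norm (Y o\<^sub>L (Y - Z)) + norm ((Y - Z) o\<^sub>L Z)) / 2"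
      by (simp add: norm_triangle_ineq)
    also have "\<dots> \<le> (norm Y * norm (Y - Z) + norm (Y - Z) * norm Z) / 2"
      by (intro divide_right_mono add_mono norm_blinfun_compose) auto
    also have "\<dots> \<le> (r * norm (Y - Z) + norm (Y - Z) * r) / 2"
      using that by (intro divide_right_mono add_mono mult_right_mono mult_left_mono) (auto simp: S_def)
    finally show ?thesis by (simp add: dist_norm)
  qed
  ultimately obtain Y where Y: "Y \<in> S" "T Y = Y"
    using Banach_fix[of S r T] r by blast
  show thesis
  proof
    have "Y v = (1/2) *\<^sub>R (E v + Y (Y v))" for v
      using arg_cong[OF Y(2), of "\<lambda>Z. Z v"] by (simp add: T_def blinfun.bilinear_simps)
    then have "2 *\<^sub>R Y v = 2 *\<^sub>R ((1/2) *\<^sub>R (E v + Y (Y v)))" for v by metis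
    then have "Y v + Y v = E v + Y (Y v)" for v by (simp add: scaleR_2)
    then show "(id_blinfun - Y) o\<^sub>L (id_blinfun - Y) = id_blinfun - E"
      by (intro blinfun_eqI) (simp add: blinfun.bilinear_simps algebra_simps)
    show "(id_blinfun - Y) u \<bullet> v = u \<bullet> (id_blinfun - Y) v" for u v
      using Y by (simp add: S_def blinfun.bilinear_simps inner_simps)
    show "1 - r > 0" using r by simp
    show "(1 - r) * (norm v)\<^sup>2 \<le> v \<bullet> (id_blinfun - Y) v" for v
    proof -
      have "v \<bullet> Y v \<le> norm v * norm (Y v)" by (rule norm_cauchy_schwarz)
      also have "\<dots> \<le> norm v * (norm Y * norm v)" by (intro mult_left_mono norm_blinfun) auto
      also have "\<dots> \<le> norm v * (r * norm v)"
        using Y by (intro mult_left_mono mult_right_mono) (auto simp: S_def)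
      finally show ?thesis
        by (simp add: blinfun.bilinear_simps inner_diff_right dot_square_norm power2_eq_square algebra_simps)
    qed
  qed
qed

text \<open>The quadratic form attains a positive minimum on the compact unit sphere, and
  homogeneity of degree two carries the bound to all vectors.\<close>

lemma pos_def_coercive:
  fixes A :: "real^'n^'n"
  assumes "pos_def A"
  obtains m where "m > 0" "\<And>v. m * (norm v)\<^sup>2 \<le> v \<bullet> (A *v v)"
proof -
  have "continuous_on (sphere 0 1) (\<lambda>v. v \<bullet> (A *v v))"
    by (intro continuous_intros matrix_vector_mult_linear_continuous_on)
  then obtain u where u: "u \<in> sphere 0 1" "\<And>v. v \<in> sphere 0 1 \<Longrightarrow> u \<bullet> (A *v u) \<le> v \<bullet> (A *v v)"
    using continuous_attains_inf[OF compact_sphere, of "0::real^'n" 1 "\<lambda>v. v \<bullet> (A *v v)"] by auto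
  show thesis
  proof
    have "u \<noteq> 0" using u(1) by auto
    then show "u \<bullet> (A *v u) > 0" using assms by (simp add: pos_def_def)
    fix v :: "real^'n"
    show "u \<bullet> (A *v u) * (norm v)\<^sup>2 \<le> v \<bullet> (A *v v)"
    proof (cases "v = 0")
      case False
      have "u \<bullet> (A *v u) \<le> (v /\<^sub>R norm v) \<bullet> (A *v (v /\<^sub>R norm v))"
        using False by (intro u(2)) auto
      also have "\<dots> = (v \<bullet> (A *v v)) / (norm v)\<^sup>2"
        using False by (simp add: matrix_vector_mult_scaleR power2_eq_square field_simps)
      finally show ?thesis using False by (simp add: field_simps)
    qed simp
  qed
qed

text \<open>For a suitable scale \<open>c\<close> the operator \<open>A / c\<close> is so close to
  the identity that the fixed point argument gives its root; \<open>sqrt c\<close> times that root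
  squares to \<open>A\<close>.\<close>

lemma pos_def_square_root_exists:
  fixes A :: "real^'n^'n"
  assumes A: "pos_def A"
  obtains B where "pos_def B" "B ** B = A"
proof -
  obtain m where m: "m > 0" "\<And>v. m * (norm v)\<^sup>2 \<le> v \<bullet> (A *v v)"
    using pos_def_coercive[OF A] by blast
  obtain K where K: "K > 0" "\<And>v. norm (A *v v) \<le> norm v * K"
    using bounded_linear.pos_bounded[OF matrix_vector_mul_bounded_linear[of A]] by blast
  \<comment> \<open>This choice minimises the bound \<open>1 - 2 m / c + K^2 / c^2\<close> for
    \<open>(norm (E v) / norm v)^2\<close>; the minimum is the \<open>q\<close> below.\<close>
  define c where "c = K\<^sup>2 / m"
  have c: "c > 0" using m K by (simp add: c_def)
  define E where "E = id_blinfun - (1/c) *\<^sub>R Blinfun ((*v) A)"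
  have [simp]: "Blinfun ((*v) A) v = A *v v" for v
    by (simp add: bounded_linear_Blinfun_apply matrix_vector_mul_bounded_linear)
  have sym: "(A *v u) \<bullet> v = u \<bullet> (A *v v)" for u v
    using A by (metis dot_lmul_matrix pos_def_def transpose_matrix_vector)
  define q where "q = 1 - m\<^sup>2 / K\<^sup>2"
  have Ev: "(norm (E v))\<^sup>2 \<le> q * (norm v)\<^sup>2" for v
  proof -
    have "(norm (E v))\<^sup>2 = (norm v)\<^sup>2 - 2 / c * (v \<bullet> (A *v v)) + (norm (A *v v))\<^sup>2 / c\<^sup>2"
      unfolding power2_norm_eq_inner E_def
      by (simp add: blinfun.bilinear_simps inner_simps inner_commute power2_eq_square algebra_simps)
    also have "\<dots> \<le> (norm v)\<^sup>2 - 2 / c * (m * (norm v)\<^sup>2) + (norm v * K)\<^sup>2 / c\<^sup>2"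
      using m K c by (intro add_mono diff_mono mult_left_mono divide_right_mono power_mono) auto
    also have "\<dots> = q * (norm v)\<^sup>2"
      using m(1) K(1) by (simp add: c_def q_def power2_eq_square field_simps)
    finally show ?thesis .
  qed
  have q: "q < 1" using m K by (simp add: q_def)
  \<comment> \<open>Evaluating at a unit vector shows \<open>0 \<le> q\<close>, so that
    \<open>sqrt q\<close> can serve as an operator norm bound.\<close>
  obtain z :: "real^'n" where "norm z = 1" using vector_choose_size[of 1] by auto
  then have q0: "0 \<le> q" using order_trans[OF _ Ev[of z], of 0] by simp
  have "norm (E v) \<le> sqrt q * norm v" for v
    using real_sqrt_le_mono[OF Ev[of v]] by (simp add: real_sqrt_mult)
  then have "norm E \<le> sqrt q" using q0 by (intro norm_blinfun_bound) auto
  then have "norm E < 1" using q by (meson le_less_trans real_sqrt_lt_1_iff)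
  moreover have "E u \<bullet> v = u \<bullet> E v" for u v
    by (simp add: E_def blinfun.bilinear_simps inner_simps sym)
  ultimately obtain B :: "(real^'n) \<Rightarrow>\<^sub>L (real^'n)" and d where
    B: "B o\<^sub>L B = id_blinfun - E" "\<And>u v. B u \<bullet> v = u \<bullet> B v"
    "d > 0" "\<And>v. d * (norm v)\<^sup>2 \<le> v \<bullet> B v"
    by (rule blinfun_square_root_near_id) blast
  define M where "M = matrix (\<lambda>v. sqrt c *\<^sub>R B v)"
  have Mv: "M *v v = sqrt c *\<^sub>R B v" for v
    unfolding M_def
    by (intro matrix_works)
      (simp add: linear_matrix_vector_mul_eq linear_compose_scale_right bounded_linear.linear blinfun.bounded_linear_right)
  show thesis
  proof
    have "u \<bullet> (transpose M *v v) = u \<bullet> (M *v v)" for u v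
      by (metis B(2) Mv dot_lmul_matrix inner_scaleR_left inner_scaleR_right transpose_matrix_vector transpose_transpose)
    then have "transpose M *v v = M *v v" for v
      by (metis vector_eq_ldot)
    then have "transpose M = M" by (simp add: matrix_eq)
    moreover have "0 < v \<bullet> (M *v v)" if "v \<noteq> 0" for v
    proof -
      have "0 < d * (norm v)\<^sup>2" using that B(3) by simp
      then show ?thesis using B(4)[of v] c by (simp add: Mv)
    qed
    ultimately show "pos_def M" by (simp add: pos_def_def)
    have "M *v (M *v v) = A *v v" for v
    proof -
      have "B (B v) = (id_blinfun - E) v" by (simp flip: B(1))
      also have "\<dots> = (1/c) *\<^sub>R (A *v v)" by (simp add: E_def blinfun.bilinear_simps)
      finally show ?thesis using c by (simp add: Mv blinfun.bilinear_simps)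
    qed
    then show "M ** M = A" by (simp add: matrix_eq flip: matrix_vector_mul_assoc)
  qed
qed

text \<open>The diagonal entries of \<open>transpose D ** B ** D\<close> are the values of the form
  of \<open>B\<close> at the columns of \<open>D\<close>. For semidefinite \<open>B\<close> a zero
  trace therefore forces each of these values to vanish.\<close>

lemma trace_conj:
  fixes B :: "real^'n^'n" and D :: "real^'m^'n"
  shows "trace (transpose D ** B ** D) = (\<Sum>i\<in>UNIV. column i D \<bullet> (B *v column i D))"
proof -
  have "(transpose D ** B ** D) $ i $ i = column i D \<bullet> (B *v column i D)" for i
    by (simp add: matrix_matrix_mult_def matrix_vector_mult_def transpose_def column_def inner_vec_def
        sum_distrib_left sum_distrib_right mult.assoc) (rule sum.swap)
  then show ?thesis by (simp add: trace_def)
qed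

text \<open>For \<open>D = B - C\<close> the hypothesis reads \<open>B D + D C = 0\<close>, so the traces of the positive
  semidefinite matrices \<open>D B D\<close> and \<open>D C D\<close> add up to zero.\<close>

lemma square_root_unique:
  fixes B C :: "real^'n^'n"
  assumes B: "pos_def B" and C: "pos_semidef C" and eq: "B ** B = C ** C"
  shows "B = C"
proof -
  define D where "D = B - C"
  have tD: "transpose D = D"
    using B C by (simp add: D_def pos_def_def pos_semidef_def transpose_def vec_eq_iff)
  have "B ** D + D ** C = 0"
    using eq by (simp add: D_def matrix_eq matrix_vector_mult_add_rdistrib
        matrix_vector_mult_diff_rdistrib matrix_vector_mult_diff_distrib flip: matrix_vector_mul_assoc)
  then have "D ** (B ** D + D ** C) = 0" by simp
  then have "D ** B ** D + D ** D ** C = 0"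
    by (simp add: matrix_add_ldistrib matrix_mul_assoc)
  then have "trace (D ** B ** D) + trace (D ** D ** C) = 0"
    by (simp add: trace_0 flip: trace_add mat_0)
  moreover have "trace (D ** D ** C) = trace (D ** C ** D)"
    by (metis matrix_mul_assoc trace_mul_sym)
  ultimately have s: "(\<Sum>i\<in>UNIV. column i D \<bullet> (B *v column i D)) + (\<Sum>i\<in>UNIV. column i D \<bullet> (C *v column i D)) = 0"
    using trace_conj[of D B] trace_conj[of D C] tD by simp
  have nB: "0 \<le> v \<bullet> (B *v v)" for v using B by (cases "v = 0") (auto simp: pos_def_def less_imp_le)
  have nC: "0 \<le> v \<bullet> (C *v v)" for v using C by (auto simp: pos_semidef_def)
  have "(\<Sum>i\<in>UNIV. column i D \<bullet> (B *v column i D)) = 0"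
    using s sum_nonneg[of UNIV "\<lambda>i. column i D \<bullet> (B *v column i D)"]
      sum_nonneg[of UNIV "\<lambda>i. column i D \<bullet> (C *v column i D)"] nB nC by simp
  then have "column i D \<bullet> (B *v column i D) = 0" for i
    by (subst (asm) sum_nonneg_eq_0_iff) (use nB in auto)
  then have "column i D = 0" for i using B by (metis less_irrefl pos_def_def)
  then have "D = 0" by (simp add: column_def vec_eq_iff)
  then show ?thesis by (simp add: D_def)
qed

text \<open>Existence and uniqueness of the root make the definite description in
  \<open>matrix_sqrt\<close> denote the positive definite root constructed above.\<close>

lemma matrix_sqrt_pos_def:
  fixes A :: "real^'n^'n"
  assumes "pos_def A"
  shows "pos_def (matrix_sqrt A)" "matrix_sqrt A ** matrix_sqrt A = A"
proof -
  obtain B where B: "pos_def B" "B ** B = A" using pos_def_square_root_exists[OF assms] by blast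
  have "pos_semidef B" using B(1) unfolding pos_def_def pos_semidef_def
    by (metis inner_zero_left order_less_imp_le order_refl)
  then have "matrix_sqrt A = B" unfolding matrix_sqrt_def
    using B square_root_unique[OF B(1)] by (intro the_equality) metis+
  then show "pos_def (matrix_sqrt A)" "matrix_sqrt A ** matrix_sqrt A = A" using B by auto
qed

section \<open>Curves and level sets\<close>

definition C1_curve :: "(real \<Rightarrow> 'a::real_normed_vector) \<Rightarrow> (real \<Rightarrow> 'a) \<Rightarrow> 'a \<Rightarrow> 'a \<Rightarrow> bool" where
  "C1_curve \<gamma> \<gamma>' a b \<longleftrightarrow>
     (\<forall>t\<in>{0..1}. (\<gamma> has_vector_derivative \<gamma>' t) (at t within {0..1})) \<and>
     continuous_on {0..1} \<gamma>' \<and> \<gamma> 0 = a \<and> \<gamma> 1 = b"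

lemma C1_curve_continuous: "C1_curve \<gamma> \<gamma>' a b \<Longrightarrow> continuous_on {0..1} \<gamma>"
  unfolding C1_curve_def continuous_on_eq_continuous_within
  by (meson has_vector_derivative_continuous)

text \<open>The analogue of \<open>fiber_rel\<close> for a single map \<open>F\<close>; stacking the
  outputs at all data points reduces \<open>fiber_rel\<close> to it.\<close>

definition level_rel :: "('a::real_normed_vector \<Rightarrow> 'b) \<Rightarrow> ('a \<times> 'a) set" where
  "level_rel F = {(a, b). \<exists>\<gamma>. \<gamma> piecewise_differentiable_on {0..1::real} \<and>
     \<gamma> 0 = a \<and> \<gamma> 1 = b \<and> (\<forall>t\<in>{0..1}. F (\<gamma> t) = F a)}"

lemma level_rel_C1:
  assumes "C1_curve \<gamma> \<gamma>' a b" "\<And>t. t \<in> {0..1} \<Longrightarrow> F (\<gamma> t) = F a"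
  shows "(a, b) \<in> level_rel F"
proof -
  have "\<gamma> differentiable_on {0..1}"
    unfolding differentiable_on_def using assms(1) by (meson C1_curve_def differentiableI_vector)
  then have "\<gamma> piecewise_differentiable_on {0..1}"
    by (rule differentiable_on_imp_piecewise_differentiable)
  then show ?thesis using assms unfolding level_rel_def C1_curve_def by blast
qed

text \<open>Constant, reversed and concatenated paths. A corner at the junction is harmless because
  only piecewise differentiability is asked for.\<close>

lemma equiv_level_rel: "equiv UNIV (level_rel F)"
proof (rule equivI)
  show "refl (level_rel F)"
    unfolding refl_on_def level_rel_def by (auto intro: piecewise_differentiable_const)
  show "sym (level_rel F)"
  proof (rule symI)
    fix a b assume "(a, b) \<in> level_rel F"
    then obtain \<gamma> where g: "\<gamma> piecewise_differentiable_on {0..1::real}" "\<gamma> 0 = a" "\<gamma> 1 = b"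
      "\<And>t. t \<in> {0..1} \<Longrightarrow> F (\<gamma> t) = F a" unfolding level_rel_def by blast
    have "(\<lambda>t::real. (-1) *\<^sub>R t + 1) ` {0..1} \<subseteq> {0..1}" by auto
    then have "(\<gamma> \<circ> (\<lambda>t. (-1) *\<^sub>R t + 1)) piecewise_differentiable_on {0..1}"
      by (intro piecewise_differentiable_affine piecewise_differentiable_on_subset[OF g(1)])
    moreover have "F (\<gamma> (1 - t)) = F b" if "t \<in> {0..1}" for t
      using g(4)[of "1 - t"] g(4)[of 1] g(3) that by simp
    ultimately show "(b, a) \<in> level_rel F"
      unfolding level_rel_def mem_Collect_eq case_prod_conv using g(2,3)
      by (intro exI[of _ "\<gamma> \<circ> (\<lambda>t. (-1) *\<^sub>R t + 1)"]) simp
  qed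
  show "trans (level_rel F)"
  proof (rule transI)
    fix a b c assume "(a, b) \<in> level_rel F" and bc: "(b, c) \<in> level_rel F"
    then obtain \<gamma> where g: "\<gamma> piecewise_differentiable_on {0..1::real}" "\<gamma> 0 = a" "\<gamma> 1 = b"
      "\<And>t. t \<in> {0..1} \<Longrightarrow> F (\<gamma> t) = F a" unfolding level_rel_def by blast
    obtain \<eta> where h: "\<eta> piecewise_differentiable_on {0..1::real}" "\<eta> 0 = b" "\<eta> 1 = c"
      "\<And>t. t \<in> {0..1} \<Longrightarrow> F (\<eta> t) = F b" using bc unfolding level_rel_def by blast
    define \<kappa> where "\<kappa> = (\<lambda>t::real. if t \<le> 1/2 then (\<gamma> \<circ> (\<lambda>t. 2 *\<^sub>R t + 0)) t else (\<eta> \<circ> (\<lambda>t. 2 *\<^sub>R t + (-1))) t)"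
    have "(\<lambda>t::real. 2 *\<^sub>R t + 0) ` {0..1/2} \<subseteq> {0..1}" by auto
    then have 1: "(\<gamma> \<circ> (\<lambda>t. 2 *\<^sub>R t + 0)) piecewise_differentiable_on {0..1/2}"
      by (intro piecewise_differentiable_affine piecewise_differentiable_on_subset[OF g(1)])
    have "(\<lambda>t::real. 2 *\<^sub>R t + (-1)) ` {1/2..1} \<subseteq> {0..1}" by auto
    then have 2: "(\<eta> \<circ> (\<lambda>t. 2 *\<^sub>R t + (-1))) piecewise_differentiable_on {1/2..1}"
      by (intro piecewise_differentiable_affine piecewise_differentiable_on_subset[OF h(1)])
    have "\<kappa> piecewise_differentiable_on {0..1}"
      unfolding \<kappa>_def using g(3) h(2) by (intro piecewise_differentiable_cases 1 2) auto
    moreover have "F (\<kappa> t) = F a" if "t \<in> {0..1}" for t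
      using that g(4)[of "2 * t"] h(4)[of "2 * t - 1"] g(4)[of 1] g(3) by (auto simp: \<kappa>_def)
    ultimately show "(a, c) \<in> level_rel F"
      unfolding level_rel_def mem_Collect_eq case_prod_conv using g(2) h(3)
      by (intro exI[of _ \<kappa>]) (simp add: \<kappa>_def)
  qed
qed auto

text \<open>The time change \<open>12 t\<^sup>2 - 16 t\<^sup>3\<close> maps \<open>[0, 1/2]\<close> onto \<open>[0, 1]\<close> with vanishing velocity
  at both ends, so that curves reparametrised in this way can be glued to a \<open>C\<^sup>1\<close> curve.\<close>

lemma C1_curve_ramp:
  fixes c :: real
  assumes C1: "C1_curve \<gamma> \<gamma>' a b"
    and N: "continuous_on {0..1} (\<lambda>t. N (\<gamma> t) (\<gamma>' t) :: real)"
    and hom: "\<And>x r v. 0 \<le> r \<Longrightarrow> N x (r *\<^sub>R v) = r * N x v"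
  obtains \<kappa> \<kappa>' where
    "\<And>t. t \<in> {c..c+1/2} \<Longrightarrow> (\<kappa> has_vector_derivative \<kappa>' t) (at t within {c..c+1/2})"
    "continuous_on {c..c+1/2} \<kappa>'"
    "\<kappa> c = a" "\<kappa> (c+1/2) = b" "\<kappa>' c = 0" "\<kappa>' (c+1/2) = 0"
    "((\<lambda>t. N (\<kappa> t) (\<kappa>' t)) has_integral integral {0..1} (\<lambda>t. N (\<gamma> t) (\<gamma>' t))) {c..c+1/2}"
proof -
  define s where "s t = 12 * (t - c)^2 - 16 * (t - c)^3" for t
  define s' where "s' t = 24 * (t - c) * (1 - 2 * (t - c))" for t
  have ds: "(s has_field_derivative s' t) (at t within S)" for t S
    unfolding s_def s'_def
    by (auto intro!: derivative_eq_intros simp: power2_eq_square power3_eq_cube algebra_simps)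
  have sc: "continuous_on S s" "continuous_on S s'" for S
    unfolding s_def s'_def by (intro continuous_intros)+
  have s'0: "0 \<le> s' t" if "t \<in> {c..c+1/2}" for t
    using that by (auto simp: s'_def)
  have s01: "s ` {c..c+1/2} \<subseteq> {0..1}"
  proof clarify
    fix t assume t: "t \<in> {c..c+1/2}"
    \<comment> \<open>With \<open>u = t - c\<close>, these two products are the factorisations
      \<open>s t = u^2 (12 - 16 u)\<close> and
      \<open>1 - s t = (1 - 2 u)^2 (1 + 4 u)\<close>.\<close>
    have "0 \<le> (t - c)^2 * (12 - 16 * (t - c))" using t by (intro mult_nonneg_nonneg) auto
    moreover have "0 \<le> (1 - 2 * (t - c))^2 * (1 + 4 * (t - c))"
      using t by (intro mult_nonneg_nonneg) auto
    ultimately show "s t \<in> {0..1}"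
      by (simp add: s_def power2_eq_square power3_eq_cube algebra_simps)
  qed
  have ends: "s c = 0" "s (c + 1/2) = 1"
    by (simp_all add: s_def power2_eq_square power3_eq_cube)
  have \<gamma>01: "\<gamma> 0 = a" "\<gamma> 1 = b" using C1 by (simp_all add: C1_curve_def)
  have \<gamma>: "(\<gamma> has_vector_derivative \<gamma>' t) (at t within {0..1})" if "t \<in> {0..1}" for t
    using that C1 by (simp add: C1_curve_def)
  show thesis
  proof
    fix t assume t: "t \<in> {c..c+1/2}"
    have "((\<gamma> \<circ> s) has_vector_derivative (s' t *\<^sub>R \<gamma>' (s t))) (at t within {c..c+1/2})"
      using t subsetD[OF s01 imageI[OF t]] ds[of t "{c..c+1/2}"]
      by (intro vector_diff_chain_within has_vector_derivative_within_subset[OF \<gamma> s01])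
        (auto simp: has_real_derivative_iff_has_vector_derivative)
    then show "((\<lambda>t. \<gamma> (s t)) has_vector_derivative (s' t *\<^sub>R \<gamma>' (s t))) (at t within {c..c+1/2})"
      by (simp add: o_def)
  next
    show "continuous_on {c..c+1/2} (\<lambda>t. s' t *\<^sub>R \<gamma>' (s t))"
      using C1 by (intro continuous_on_scaleR sc continuous_on_compose2[OF _ sc(1) s01]) (simp add: C1_curve_def)
  next
    \<comment> \<open>Substitution produces the factor \<open>s' t\<close> outside \<open>N\<close>;
      being nonnegative, it can be moved onto the velocity by homogeneity, so the time change
      preserves length.\<close>
    have "((\<lambda>t. s' t *\<^sub>R N (\<gamma> (s t)) (\<gamma>' (s t))) has_integral integral {s c..s (c+1/2)} (\<lambda>t. N (\<gamma> t) (\<gamma>' t))) {c..c+1/2}"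
      by (rule has_integral_substitution[OF _ _ s01 N ds]) (simp_all add: ends[simplified])
    then have "((\<lambda>t. s' t *\<^sub>R N (\<gamma> (s t)) (\<gamma>' (s t))) has_integral integral {0..1} (\<lambda>t. N (\<gamma> t) (\<gamma>' t))) {c..c+1/2}"
      by (simp only: ends)
    then show "((\<lambda>t. N (\<gamma> (s t)) (s' t *\<^sub>R \<gamma>' (s t))) has_integral integral {0..1} (\<lambda>t. N (\<gamma> t) (\<gamma>' t))) {c..c+1/2}"
      by (rule has_integral_eq[rotated]) (simp only: hom[OF s'0] real_scaleR_def)
  next
    show "\<gamma> (s c) = a" "\<gamma> (s (c + 1/2)) = b" by (simp_all only: ends \<gamma>01)
    show "s' c *\<^sub>R \<gamma>' (s c) = 0" by (simp add: s'_def)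
    show "s' (c + 1/2) *\<^sub>R \<gamma>' (s (c + 1/2)) = 0" by (simp add: s'_def)
  qed
qed

text \<open>Each curve is traversed on half of the interval with zero velocity at both ends, so the
  velocities agree at \<open>1/2\<close>. Here \<open>N x v\<close> stands for a speed, homogeneous
  in \<open>v\<close> for nonnegative factors.\<close>

lemma C1_curve_append:
  assumes 1: "C1_curve \<gamma> \<gamma>' a b" and 2: "C1_curve \<eta> \<eta>' b c"
    and N: "continuous_on {0..1} (\<lambda>t. N (\<gamma> t) (\<gamma>' t) :: real)"
      "continuous_on {0..1} (\<lambda>t. N (\<eta> t) (\<eta>' t))" "\<And>x r v. 0 \<le> r \<Longrightarrow> N x (r *\<^sub>R v) = r * N x v"
  obtains \<kappa> \<kappa>' where "C1_curve \<kappa> \<kappa>' a c"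
    "integral {0..1} (\<lambda>t. N (\<kappa> t) (\<kappa>' t)) =
        integral {0..1} (\<lambda>t. N (\<gamma> t) (\<gamma>' t)) + integral {0..1} (\<lambda>t. N (\<eta> t) (\<eta>' t))"
proof -
  obtain \<alpha> \<alpha>' where \<alpha>: "\<And>t. t \<in> {0..1/2} \<Longrightarrow> (\<alpha> has_vector_derivative \<alpha>' t) (at t within {0..1/2})"
    "continuous_on {0..1/2} \<alpha>'" "\<alpha> 0 = a" "\<alpha> (1/2) = b" "\<alpha>' (1/2) = 0"
    and i\<alpha>: "((\<lambda>t. N (\<alpha> t) (\<alpha>' t)) has_integral integral {0..1} (\<lambda>t. N (\<gamma> t) (\<gamma>' t))) {0..1/2}"
    by (rule C1_curve_ramp[where N = N and c = 0, OF 1 N(1)]) (rule N(3), assumption, simp only: add_0_left, blast)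
  obtain \<beta> \<beta>' where \<beta>: "\<And>t. t \<in> {1/2..1} \<Longrightarrow> (\<beta> has_vector_derivative \<beta>' t) (at t within {1/2..1})"
    "continuous_on {1/2..1} \<beta>'" "\<beta> (1/2) = b" "\<beta> 1 = c" "\<beta>' (1/2) = 0"
    and i\<beta>: "((\<lambda>t. N (\<beta> t) (\<beta>' t)) has_integral integral {0..1} (\<lambda>t. N (\<eta> t) (\<eta>' t))) {1/2..1}"
    by (rule C1_curve_ramp[where N = N and c = "1/2", OF 2 N(2)]) (rule N(3), assumption, simp only: field_sum_of_halves, blast)
  define \<kappa> where "\<kappa> t = (if t \<in> {0..1/2} then \<alpha> t else \<beta> t)" for t
  define \<kappa>' where "\<kappa>' t = (if t \<in> {0..1/2} then \<alpha>' t else \<beta>' t)" for t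
  \<comment> \<open>The gluing rule for derivatives enlarges each half by the common part of the
    closures, which adds nothing to these closed intervals.\<close>
  have U: "{0..1/2::real} \<union> ({0..1/2} \<inter> {1/2..1}) = {0..1/2}"
      "{1/2..1::real} \<union> ({0..1/2} \<inter> {1/2..1}) = {1/2..1}"
      "{0..1/2::real} \<union> {1/2..1} = {0..1}" by auto
  have cl: "closure {0..1/2::real} = {0..1/2}" "closure {1/2..1::real} = {1/2..1}"
    by (simp_all add: closure_closed)
  have meet: "t = 1/2" if "t \<in> {0..1/2}" "t \<in> {1/2..1}" for t :: real using that by auto
  then have eq: "\<alpha> t = \<beta> t" "\<alpha>' t = \<beta>' t" if "t \<in> {0..1/2}" "t \<in> {1/2..1}" for t
    using \<alpha>(4,5) \<beta>(3,5) that by metis+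
  show thesis
  proof
    have "(\<kappa> has_vector_derivative \<kappa>' t) (at t within {0..1})" if t: "t \<in> {0..1}" for t
      unfolding \<kappa>_def \<kappa>'_def
      by (rule has_vector_derivative_If_within_closures[where T = "{1/2..1}"])
        (unfold cl U, use t in \<open>auto intro: \<alpha>(1) \<beta>(1) eq\<close>)
    moreover have "continuous_on {0..1} \<kappa>'"
      unfolding \<kappa>'_def U(3)[symmetric]
      by (rule continuous_on_If) (use \<alpha>(2) \<beta>(2) eq in auto)
    ultimately show "C1_curve \<kappa> \<kappa>' a c"
      using \<alpha>(3) \<beta>(4) by (simp add: C1_curve_def \<kappa>_def)
    have A: "((\<lambda>t. N (\<kappa> t) (\<kappa>' t)) has_integral integral {0..1} (\<lambda>t. N (\<gamma> t) (\<gamma>' t))) {0..1/2}"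
      by (rule has_integral_eq[OF _ i\<alpha>]) (auto simp: \<kappa>_def \<kappa>'_def)
    have B: "((\<lambda>t. N (\<kappa> t) (\<kappa>' t)) has_integral integral {0..1} (\<lambda>t. N (\<eta> t) (\<eta>' t))) {1/2..1}"
      by (rule has_integral_eq[OF _ i\<beta>])
        (use eq in \<open>auto simp: \<kappa>_def \<kappa>'_def\<close>)
    show "integral {0..1} (\<lambda>t. N (\<kappa> t) (\<kappa>' t)) =
        integral {0..1} (\<lambda>t. N (\<gamma> t) (\<gamma>' t)) + integral {0..1} (\<lambda>t. N (\<eta> t) (\<eta>' t))"
      by (rule integral_unique[OF has_integral_combine[OF _ _ A B]]) auto
  qed
qed

text \<open>\<open>\<lambda>w. (w - a) + R (F w - F a - J a (w - a))\<close> has derivative the identity at \<open>a\<close>, and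
  applying \<open>J a\<close> to it returns \<open>F w - F a\<close>; its local inverse \<open>g\<close> therefore flattens the level
  sets of \<open>F\<close> to translates of the kernel of \<open>J a\<close>.\<close>

lemma submersion_straightening:
  fixes F :: "'a::euclidean_space \<Rightarrow> 'b::real_normed_vector" and J :: "'a \<Rightarrow> 'a \<Rightarrow>\<^sub>L 'b"
  assumes deriv: "\<And>w. (F has_derivative J w) (at w)" and contJ: "continuous_on UNIV J"
    and R: "J a o\<^sub>L R = id_blinfun"
  obtains U r g g' where "open U" "a \<in> U" "0 < r" "g 0 = a" "U \<subseteq> g ` ball 0 r"
    "\<And>y. y \<in> ball 0 r \<Longrightarrow> F (g y) = F a + J a y"
    "\<And>y. y \<in> ball 0 r \<Longrightarrow> (g has_derivative g' y) (at y)"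
    "g' 0 = (\<lambda>v. v)" "\<And>v. continuous_on (ball 0 r) (\<lambda>y. g' y v)"
proof -
  define G where "G w = (w - a) + R (F w - F a - J a (w - a))" for w
  define G' where "G' w = id_blinfun + (R o\<^sub>L (J w - J a))" for w
  have JR: "J a (R z) = z" for z using arg_cong[OF R, of "\<lambda>T. T z"] by simp
  have dG: "(G has_derivative G' w) (at w)" for w
    unfolding G_def
    by (rule derivative_eq_intros deriv refl)+ (simp add: G'_def blinfun.bilinear_simps fun_eq_iff)
  have cG: "continuous_on UNIV G'"
    unfolding G'_def by (intro continuous_intros contJ)
  \<comment> \<open>On \<open>W\<close> the derivative \<open>G'\<close> stays within 1/2 of the
    identity, which yields the uniform bound \<open>lower\<close> on its inverses.\<close>
  define W where "W = G' -` ball id_blinfun (1/2)"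
  have W: "open W" unfolding W_def by (intro open_vimage cG open_ball)
  have G'a: "G' a = id_blinfun" by (rule blinfun_eqI) (simp add: G'_def blinfun.bilinear_simps)
  have aW: "a \<in> W" by (simp add: W_def G'a)
  have inv: "id_blinfun o\<^sub>L G' a = id_blinfun" by (rule blinfun_eqI) (simp add: G'a)
  have Ga: "G a = 0" by (simp add: G_def blinfun.bilinear_simps)
  obtain U V g g' where UV: "open U" "U \<subseteq> W" "a \<in> U" "open V" "G a \<in> V" "homeomorphism U V G g"
    and dg: "\<And>y. y \<in> V \<Longrightarrow> (g has_derivative g' y) (at y)"
    and g': "\<And>y. y \<in> V \<Longrightarrow> g' y = inv (blinfun_apply (G' (g y)))"
    and bij: "\<And>y. y \<in> V \<Longrightarrow> bij (blinfun_apply (G' (g y)))"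
    by (rule inverse_function_theorem[OF W dG continuous_on_subset[OF cG] aW inv]) auto
  obtain r where r: "0 < r" "ball 0 r \<subseteq> V"
    using UV(4,5) Ga by (metis open_contains_ball)
  have GV: "G (g y) = y" "g y \<in> U" if "y \<in> ball 0 r" for y
    using that r UV(6) by (auto simp: homeomorphism_def)
  have gU: "g (G w) = w" if "w \<in> U" for w
    using that UV(6) by (auto simp: homeomorphism_def)
  have G'g': "G' (g y) (g' y v) = v" if "y \<in> ball 0 r" for y v
    using bij[of y] g'[of y] that r by (auto simp: bij_is_surj surj_f_inv_f)
  have lower: "norm v \<le> 2 * norm (G' w v)" if "w \<in> U" for w v
  proof -
    have "norm (id_blinfun - G' w) \<le> 1/2" using that UV(2) by (auto simp: W_def dist_norm)
    then have "norm ((id_blinfun - G' w) v) \<le> 1/2 * norm v"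
      by (meson norm_blinfun norm_ge_zero mult_right_mono order_trans)
    then have "norm (v - G' w v) \<le> 1/2 * norm v" by (simp add: blinfun.bilinear_simps)
    then show ?thesis using norm_triangle_ineq2[of v "G' w v"] by linarith
  qed
  show thesis
  proof
    show "open (U \<inter> G -` ball 0 r)"
      by (intro open_Int UV open_vimage open_ball)
        (meson dG continuous_at_imp_continuous_on has_derivative_continuous)
    show "a \<in> U \<inter> G -` ball 0 r" using UV r Ga by simp
    show "0 < r" by (rule r)
    show g0: "g 0 = a" using gU[OF UV(3)] Ga by simp
    show "U \<inter> G -` ball 0 r \<subseteq> g ` ball 0 r" using gU by (metis IntE imageI subsetI vimageE)
    show "F (g y) = F a + J a y" if "y \<in> ball 0 r" for y
    proof -
      \<comment> \<open>Because \<open>J a (R z) = z\<close>, the linear terms cancel and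
        \<open>J a (G w) = F w - F a\<close>.\<close>
      have "J a y = J a (G (g y))" by (simp only: GV(1)[OF that])
      also have "\<dots> = F (g y) - F a" by (simp add: G_def blinfun.bilinear_simps JR)
      finally show ?thesis by simp
    qed
    show "(g has_derivative g' y) (at y)" if "y \<in> ball 0 r" for y using that dg r by blast
    show "g' 0 = (\<lambda>v. v)"
      using G'g'[of 0] r(1) by (simp add: g0 G'a fun_eq_iff)
    \<comment> \<open>Applying \<open>G' (g y)\<close> to the increment of \<open>g'\<close> leaves
      \<open>G' (g y0) - G' (g y)\<close> at a fixed vector; \<open>lower\<close> turns its
      convergence to zero into continuity of \<open>g'\<close>.\<close>
    show "continuous_on (ball 0 r) (\<lambda>y. g' y v)" for v
    proof (rule continuous_on_eq_continuous_at[THEN iffD2, OF open_ball], rule ballI)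
      fix y0 :: 'a assume y0: "y0 \<in> ball 0 r"
      have "isCont g y0" using dg y0 r has_derivative_continuous by blast
      moreover have "isCont G' (g y0)" using cG by (simp add: continuous_on_eq_continuous_at)
      ultimately have "((\<lambda>y. G' (g y)) \<longlongrightarrow> G' (g y0)) (at y0)"
        using isCont_o2[of y0 g G'] by (simp add: isCont_def)
      then have "((\<lambda>y. 2 * norm ((G' (g y0) - G' (g y)) (g' y0 v))) \<longlongrightarrow> 2 * norm ((G' (g y0) - G' (g y0)) (g' y0 v))) (at y0)"
        by (intro tendsto_intros)
      then have lim: "((\<lambda>y. 2 * norm ((G' (g y0) - G' (g y)) (g' y0 v))) \<longlongrightarrow> 0) (at y0)" by simp
      have "\<forall>\<^sub>F y in at y0. norm (g' y v - g' y0 v) \<le> 2 * norm ((G' (g y0) - G' (g y)) (g' y0 v))"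
        unfolding eventually_at_topological
      proof (intro exI[of _ "ball 0 r"] conjI ballI impI open_ball y0)
        fix y :: 'a assume y: "y \<in> ball 0 r"
        have "G' (g y) (g' y v - g' y0 v) = (G' (g y0) - G' (g y)) (g' y0 v)"
          by (simp add: blinfun.bilinear_simps G'g'[OF y] G'g'[OF y0])
        then show "norm (g' y v - g' y0 v) \<le> 2 * norm ((G' (g y0) - G' (g y)) (g' y0 v))"
          using lower[OF GV(2)[OF y], of "g' y v - g' y0 v"] by simp
      qed
      from Lim_null_comparison[OF this lim] show "isCont (\<lambda>y. g' y v) y0"
        unfolding isCont_def by (rule Lim_null[THEN iffD2])
    qed
  qed
qed

text \<open>Images of segments under a chart \<open>g\<close>. When \<open>g\<close> flattens a
  level set, segments in the kernel of the derivative become curves in that level set.\<close>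

lemma C1_curve_line:
  assumes "convex S" "y0 \<in> S" "y1 \<in> S" and g: "\<And>y. y \<in> S \<Longrightarrow> (g has_derivative g' y) (at y)"
    and cont: "\<And>v. continuous_on S (\<lambda>y. g' y v)"
  shows "C1_curve (\<lambda>t. g ((1 - t) *\<^sub>R y0 + t *\<^sub>R y1)) (\<lambda>t. g' ((1 - t) *\<^sub>R y0 + t *\<^sub>R y1) (y1 - y0))
    (g y0) (g y1)"
proof -
  have S: "(1 - t) *\<^sub>R y0 + t *\<^sub>R y1 \<in> S" if "t \<in> {0..1}" for t
    using assms(1-3) that by (simp add: convex_alt)
  have "((\<lambda>t. g ((1 - t) *\<^sub>R y0 + t *\<^sub>R y1)) has_derivative
      (\<lambda>h. g' ((1 - t) *\<^sub>R y0 + t *\<^sub>R y1) (h *\<^sub>R (y1 - y0)))) (at t within {0..1})" if "t \<in> {0..1}" for t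
  proof (rule has_derivative_compose[of "\<lambda>t. (1 - t) *\<^sub>R y0 + t *\<^sub>R y1", OF _ g[OF S[OF that]]])
    show "((\<lambda>t. (1 - t) *\<^sub>R y0 + t *\<^sub>R y1) has_derivative (\<lambda>h. h *\<^sub>R (y1 - y0))) (at t within {0..1})"
      by (auto intro!: derivative_eq_intros simp: algebra_simps)
  qed
  moreover have "g' y (h *\<^sub>R v) = h *\<^sub>R g' y v" if "y \<in> S" for y h v
    using g[OF that] by (simp add: has_derivative_linear linear_scale)
  ultimately have "((\<lambda>t. g ((1 - t) *\<^sub>R y0 + t *\<^sub>R y1)) has_vector_derivative
      g' ((1 - t) *\<^sub>R y0 + t *\<^sub>R y1) (y1 - y0)) (at t within {0..1})" if "t \<in> {0..1}" for t
    using that S by (simp add: has_vector_derivative_def)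
  moreover have "continuous_on {0..1} (\<lambda>t. g' ((1 - t) *\<^sub>R y0 + t *\<^sub>R y1) (y1 - y0))"
    by (rule continuous_on_compose2[OF cont]) (use S in \<open>auto intro!: continuous_intros\<close>)
  ultimately show ?thesis by (simp add: C1_curve_def)
qed

lemma C1_curve_segment: "C1_curve (\<lambda>t. (1 - t) *\<^sub>R a + t *\<^sub>R b) (\<lambda>t. b - a) a b"
  using C1_curve_line[of UNIV a b "\<lambda>x. x" "\<lambda>_ x. x"] by simp

section \<open>Quotient distances\<close>

text \<open>One admissible value of the infimum in \<open>quot_dist\<close>, with the number of
  steps and the points hidden, so that chains can be concatenated.\<close>

definition quot_chain :: "('a::real_normed_vector \<times> 'a) set \<Rightarrow> 'a set \<Rightarrow> 'a set \<Rightarrow> real \<Rightarrow> bool" where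
  "quot_chain R A B s \<longleftrightarrow> (\<exists>(n::nat) p q. s = (\<Sum>i=1..n. norm (p i - q i)) \<and>
     1 \<le> n \<and> A = R `` {p 1} \<and> (\<forall>i\<in>{1..<n}. R `` {p (i + 1)} = R `` {q i}) \<and> R `` {q n} = B)"

lemma quot_dist_eq_Inf: "quot_dist R A B = Inf {s. quot_chain R A B s}"
  unfolding quot_dist_def quot_chain_def by (rule arg_cong[where f = Inf]) blast

lemma quot_chain_nonneg: "quot_chain R A B s \<Longrightarrow> 0 \<le> s"
  by (auto simp: quot_chain_def intro!: sum_nonneg)

lemma quot_chain_single: "quot_chain R (R `` {p}) (R `` {q}) (norm (p - q))"
  unfolding quot_chain_def by (intro exI[of _ "1::nat"] exI[of _ "\<lambda>_. p"] exI[of _ "\<lambda>_. q"]) auto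

text \<open>The second chain is appended with its indices shifted by the number \<open>n\<close> of
  steps of the first; the linking condition at \<open>n\<close> holds because both classes are
  \<open>B\<close>.\<close>

lemma quot_chain_append:
  assumes "quot_chain R A B s" "quot_chain R B C t"
  shows "quot_chain R A C (s + t)"
proof -
  obtain n :: nat and p q where 1: "s = (\<Sum>i=1..n. norm (p i - q i))" "1 \<le> n" "A = R `` {p 1}"
     "\<And>i. i\<in>{1..<n} \<Longrightarrow> R `` {p (i + 1)} = R `` {q i}" "R `` {q n} = B"
    using assms(1) unfolding quot_chain_def by blast
  obtain m :: nat and p' q' where 2: "t = (\<Sum>i=1..m. norm (p' i - q' i))" "1 \<le> m" "B = R `` {p' 1}"
     "\<And>i. i\<in>{1..<m} \<Longrightarrow> R `` {p' (i + 1)} = R `` {q' i}" "R `` {q' m} = C"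
    using assms(2) unfolding quot_chain_def by blast
  define P where "P i = (if i \<le> n then p i else p' (i - n))" for i
  define Q where "Q i = (if i \<le> n then q i else q' (i - n))" for i
  have "(\<Sum>i=1..n+m. norm (P i - Q i)) = (\<Sum>i=1..n. norm (P i - Q i)) + (\<Sum>i=n+1..n+m. norm (P i - Q i))"
    by (rule sum.ub_add_nat) simp
  also have "(\<Sum>i=1..n. norm (P i - Q i)) = s" using 1(1) by (auto simp: P_def Q_def)
  also have "(\<Sum>i=n+1..n+m. norm (P i - Q i)) = (\<Sum>i=1..m. norm (P (i + n) - Q (i + n)))"
    using sum.shift_bounds_cl_nat_ivl[of "\<lambda>i. norm (P i - Q i)" 1 n m] by (simp add: add.commute)
  also have "\<dots> = t" using 2(1) by (auto simp: P_def Q_def intro!: sum.cong)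
  finally have "s + t = (\<Sum>i=1..n+m. norm (P i - Q i))" by simp
  moreover have "R `` {P (i + 1)} = R `` {Q i}" if i: "i \<in> {1..<n+m}" for i
  proof -
    consider "i < n" | "i = n" | "i > n" by linarith
    then show ?thesis
    proof cases
      case 1 then show ?thesis using \<open>\<And>i. i\<in>{1..<n} \<Longrightarrow> _\<close>[of i] i by (simp add: P_def Q_def)
    next
      case 2 then show ?thesis using \<open>B = _\<close> \<open>_ = B\<close> by (simp add: P_def Q_def)
    next
      case 3
      then have "P (i + 1) = p' (i - n + 1)" "Q i = q' (i - n)"
        by (simp_all add: P_def Q_def Suc_diff_le)
      moreover have "i - n \<in> {1..<m}" using 3 i by auto
      ultimately show ?thesis using 2(4) by simp
    qed
  qed
  ultimately show ?thesis unfolding quot_chain_def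
    using 1(2,3) 2(2,5) by (intro exI[of _ "n + m"] exI[of _ P] exI[of _ Q]) (auto simp: P_def Q_def)
qed

lemma quot_dist_le: "quot_chain R A B s \<Longrightarrow> quot_dist R A B \<le> s"
  unfolding quot_dist_eq_Inf by (intro cInf_lower bdd_belowI[of _ 0]) (auto dest: quot_chain_nonneg)

lemma quot_dist_less:
  assumes "quot_dist R (R `` {a}) (R `` {b}) < s"
  obtains t where "quot_chain R (R `` {a}) (R `` {b}) t" "t < s"
  using assms quot_chain_single[of R a b] unfolding quot_dist_eq_Inf
  by (subst (asm) cInf_less_iff) (auto intro!: bdd_belowI[of _ 0] dest: quot_chain_nonneg)

lemma quot_dist_le_norm: "quot_dist R (R `` {a}) (R `` {b}) \<le> norm (a - b)"
  by (intro quot_dist_le quot_chain_single)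

lemma quot_dist_triangle:
  "quot_dist R (R `` {a}) (R `` {c}) \<le>
    quot_dist R (R `` {a}) (R `` {b}) + quot_dist R (R `` {b}) (R `` {c})"
proof (rule field_le_epsilon)
  fix e :: real assume e: "0 < e"
  obtain s where s: "quot_chain R (R `` {a}) (R `` {b}) s" "s < quot_dist R (R `` {a}) (R `` {b}) + e/2"
    by (rule quot_dist_less[of R a b "quot_dist R (R `` {a}) (R `` {b}) + e/2"]) (use e in auto)
  obtain t where t: "quot_chain R (R `` {b}) (R `` {c}) t" "t < quot_dist R (R `` {b}) (R `` {c}) + e/2"
    by (rule quot_dist_less[of R b c "quot_dist R (R `` {b}) (R `` {c}) + e/2"]) (use e in auto)
  show "quot_dist R (R `` {a}) (R `` {c}) \<le>
    quot_dist R (R `` {a}) (R `` {b}) + quot_dist R (R `` {b}) (R `` {c}) + e"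
    using quot_dist_le[OF quot_chain_append[OF s(1) t(1)]] s(2) t(2) by linarith
qed

text \<open>Jumps inside a class cost nothing for \<open>d\<close>, and each step from
  \<open>p i\<close> to \<open>q i\<close> costs at most \<open>c\<close> times its length; the
  triangle inequality adds these up along the chain. It is applied with \<open>d\<close> the
  geodesic pseudo-distance.\<close>

lemma quot_chain_sum_bound:
  assumes chain: "quot_chain R (R `` {a}) (R `` {b}) s" and "refl R"
    and triangle: "\<And>x y z. d x z \<le> d x y + d y z"
    and rel: "\<And>x y. (x, y) \<in> R \<Longrightarrow> d x y \<le> 0"
    and le: "\<And>x y. d x y \<le> c * norm (x - y)"
  shows "d a b \<le> c * s"
proof -
  \<comment> \<open>Reflexivity puts \<open>y\<close> into its own class, hence
    \<open>(x, y)\<close> into \<open>R\<close>.\<close>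
  have eq: "d x y \<le> 0" if "R `` {x} = R `` {y}" for x y
    using that \<open>refl R\<close> by (intro rel) (auto simp: refl_on_def)
  obtain n :: nat and p q where 1: "s = (\<Sum>i=1..n. norm (p i - q i))" "1 \<le> n" "R `` {a} = R `` {p 1}"
     "\<And>i. i\<in>{1..<n} \<Longrightarrow> R `` {p (i + 1)} = R `` {q i}" "R `` {q n} = R `` {b}"
    using chain unfolding quot_chain_def by blast
  have "d a (q k) \<le> c * (\<Sum>i=1..k. norm (p i - q i))" if "1 \<le> k" "k \<le> n" for k
    using that
  proof (induction k rule: dec_induct)
    case base
    then show ?case using triangle[of a "q 1" "p 1"] eq[OF 1(3)] le[of "p 1" "q 1"] by simp
  next
    case (step k)
    have "d (q k) (p (k + 1)) \<le> 0" using 1(4)[of k] step by (intro eq) auto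
    then have "d a (q (Suc k)) \<le> d a (q k) + d (p (Suc k)) (q (Suc k))"
      using triangle[of a "q (Suc k)" "q k"] triangle[of "q k" "q (Suc k)" "p (Suc k)"] by simp
    also have "\<dots> \<le> c * (\<Sum>i=1..k. norm (p i - q i)) + c * norm (p (Suc k) - q (Suc k))"
      using step le by (intro add_mono) auto
    finally show ?case using step by (simp add: distrib_left)
  qed
  from this[of n] show ?thesis using 1 triangle[of a b "q n"] eq[OF 1(5)] by simp
qed

section \<open>Geodesic distances\<close>

lemma continuous_on_matrix_vector_mult [continuous_intros]:
  fixes A :: "'a::topological_space \<Rightarrow> real^'n^'m"
  assumes "continuous_on S A" "continuous_on S v"
  shows "continuous_on S (\<lambda>x. A x *v v x)"
  unfolding matrix_vector_mult_def using assms by (intro continuous_intros)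

locale metric_field =
  fixes G :: "real^'d \<Rightarrow> real^'d^'d"
  assumes cont: "continuous_on UNIV G"
    and psd: "0 \<le> v \<bullet> (G w *v v)"
begin

definition speed :: "real^'d \<Rightarrow> real^'d \<Rightarrow> real" where
  "speed w v = sqrt (v \<bullet> (G w *v v))"

lemma speed_nonneg: "0 \<le> speed w v"
  by (simp add: speed_def psd)

lemma speed_scaleR: "0 \<le> r \<Longrightarrow> speed w (r *\<^sub>R v) = r * speed w v"
  by (simp add: speed_def matrix_vector_mult_scaleR real_sqrt_mult mult.assoc[symmetric])

lemma speed_continuous:
  assumes "C1_curve \<gamma> \<gamma>' a b"
  shows "continuous_on {0..1} (\<lambda>t. speed (\<gamma> t) (\<gamma>' t))"
  unfolding speed_def
  using assms C1_curve_continuous[OF assms]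
  by (intro continuous_intros continuous_on_compose2[OF cont]) (auto simp: C1_curve_def)

lemma geod_dist_eq: "geod_dist G a b =
    Inf {integral {0..1} (\<lambda>t. speed (\<gamma> t) (\<gamma>' t)) | \<gamma> \<gamma>'. C1_curve \<gamma> \<gamma>' a b}"
  by (simp add: geod_dist_def speed_def C1_curve_def)

text \<open>For a non-integrable integrand the integral is 0 by convention. The lengths in
  \<open>geod_dist\<close> are thus bounded below.\<close>

lemma length_nonneg: "0 \<le> integral {0..1} (\<lambda>t. speed (\<gamma> t) (\<gamma>' t))"
  by (cases "(\<lambda>t. speed (\<gamma> t) (\<gamma>' t)) integrable_on {0..1}")
    (auto simp: not_integrable_integral speed_nonneg intro: integral_nonneg)

lemma geod_dist_le: "C1_curve \<gamma> \<gamma>' a b \<Longrightarrow> geod_dist G a b \<le> integral {0..1} (\<lambda>t. speed (\<gamma> t) (\<gamma>' t))"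
  unfolding geod_dist_eq
  by (rule cInf_lower) (auto intro!: bdd_belowI[of _ 0] length_nonneg)

lemma geod_dist_less:
  assumes "geod_dist G a b < s"
  obtains \<gamma> \<gamma>' where "C1_curve \<gamma> \<gamma>' a b" "integral {0..1} (\<lambda>t. speed (\<gamma> t) (\<gamma>' t)) < s"
proof -
  have "{integral {0..1} (\<lambda>t. speed (\<gamma> t) (\<gamma>' t)) | \<gamma> \<gamma>'. C1_curve \<gamma> \<gamma>' a b} \<noteq> {}"
    using C1_curve_segment[of a b] by blast
  from cInf_lessD[OF this assms[unfolded geod_dist_eq]] show thesis using that by blast
qed

lemma geod_dist_triangle: "geod_dist G a c \<le> geod_dist G a b + geod_dist G b c"
proof (rule field_le_epsilon)
  fix e :: real assume e: "0 < e"
  obtain \<gamma> \<gamma>' where g: "C1_curve \<gamma> \<gamma>' a b"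
    "integral {0..1} (\<lambda>t. speed (\<gamma> t) (\<gamma>' t)) < geod_dist G a b + e/2"
    by (rule geod_dist_less[of a b "geod_dist G a b + e/2"]) (use e in auto)
  obtain \<eta> \<eta>' where h: "C1_curve \<eta> \<eta>' b c"
    "integral {0..1} (\<lambda>t. speed (\<eta> t) (\<eta>' t)) < geod_dist G b c + e/2"
    by (rule geod_dist_less[of b c "geod_dist G b c + e/2"]) (use e in auto)
  obtain \<kappa> \<kappa>' where k: "C1_curve \<kappa> \<kappa>' a c" "integral {0..1} (\<lambda>t. speed (\<kappa> t) (\<kappa>' t)) =
      integral {0..1} (\<lambda>t. speed (\<gamma> t) (\<gamma>' t)) + integral {0..1} (\<lambda>t. speed (\<eta> t) (\<eta>' t))"
    by (rule C1_curve_append[where N = speed, OF g(1) h(1) speed_continuous[OF g(1)]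
        speed_continuous[OF h(1)] speed_scaleR])
  show "geod_dist G a c \<le> geod_dist G a b + geod_dist G b c + e"
    using geod_dist_le[OF k(1)] k(2) g(2) h(2) by linarith
qed

end

section \<open>Comparison of the two distances for a submersion\<close>

text \<open>The constants bound speeds, so \<open>l\<close> and \<open>L\<close> stand for the
  square roots of the bounds on the NTK. In \<open>horizontal\<close>, the vector \<open>u\<close>
  represents \<open>v\<close> modulo the kernel of \<open>J w\<close>: the part of the velocity that
  motion in the fibre cannot absorb.\<close>

locale submersion_metric = metric_field G
  for G :: "real^'d \<Rightarrow> real^'d^'d" +
  fixes F :: "real^'d \<Rightarrow> 'b::euclidean_space"
    and J :: "real^'d \<Rightarrow> (real^'d) \<Rightarrow>\<^sub>L 'b"
    and l L :: real
  assumes deriv: "(F has_derivative J w) (at w)"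
    and contJ: "continuous_on UNIV J"
    and surj_J: "surj (blinfun_apply (J w))"
    and l_pos: "0 < l"
    and speed_kernel: "J w v = 0 \<Longrightarrow> speed w v = 0"
    and speed_upper: "speed w v \<le> L * norm v"
    and horizontal: "\<exists>u. J w u = J w v \<and> l * norm u \<le> speed w v"
begin

section \<open>Flat charts and curves inside level sets\<close>

lemma straightening:
  obtains U r g g' where "open U" "a \<in> U" "0 < r" "g 0 = a" "U \<subseteq> g ` ball 0 r"
    "\<And>y. y \<in> ball 0 r \<Longrightarrow> F (g y) = F a + J a y"
    "\<And>y. y \<in> ball 0 r \<Longrightarrow> (g has_derivative g' y) (at y)"
    "g' 0 = (\<lambda>v. v)" "\<And>v. continuous_on (ball 0 r) (\<lambda>y. g' y v)"
proof -
  obtain R where R: "linear R" "blinfun_apply (J a) \<circ> R = id"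
    using linear_surjective_right_inverse[OF _ surj_J[of a]]
      blinfun.bounded_linear_right bounded_linear.linear by blast
  have "J a o\<^sub>L Blinfun R = id_blinfun"
    using R by (intro blinfun_eqI)
      (simp add: bounded_linear_Blinfun_apply linear_conv_bounded_linear[symmetric] fun_eq_iff)
  from submersion_straightening[OF deriv contJ this] that show thesis by blast
qed

lemma level_derivative:
  assumes C1: "C1_curve \<gamma> \<gamma>' a b" and level: "\<And>t. t \<in> {0..1} \<Longrightarrow> F (\<gamma> t) = F a" and t: "t \<in> {0..1}"
  shows "J (\<gamma> t) (\<gamma>' t) = 0"
proof -
  have "(\<gamma> has_derivative (\<lambda>h. h *\<^sub>R \<gamma>' t)) (at t within {0..1})"
    using C1 t by (simp add: C1_curve_def has_vector_derivative_def)
  from has_derivative_compose[OF this deriv]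
  have "((\<lambda>t. F (\<gamma> t)) has_vector_derivative J (\<gamma> t) (\<gamma>' t)) (at t within {0..1})"
    by (simp add: has_vector_derivative_def blinfun.scaleR_right)
  moreover have "((\<lambda>t. F (\<gamma> t)) has_vector_derivative 0) (at t within {0..1})"
    by (rule has_vector_derivative_transform[OF t level has_vector_derivative_const])
  ultimately show ?thesis
    using t by (intro vector_derivative_unique_within_closed_interval[of 0 1 t]) auto
qed

lemma geod_dist_level_C1:
  assumes C1: "C1_curve \<gamma> \<gamma>' a b" and level: "\<And>t. t \<in> {0..1} \<Longrightarrow> F (\<gamma> t) = F a"
  shows "geod_dist G a b \<le> 0"
proof -
  have "speed (\<gamma> t) (\<gamma>' t) = 0" if "t \<in> {0..1}" for t
    using level_derivative[OF C1 level that] by (rule speed_kernel)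
  then have "integral {0..1} (\<lambda>t. speed (\<gamma> t) (\<gamma>' t)) = integral {0..1} (\<lambda>t::real. 0 :: real)"
    by (rule Henstock_Kurzweil_Integration.integral_cong)
  then show ?thesis using geod_dist_le[OF C1] by simp
qed

text \<open>In the straightening chart the level set is the part of the kernel of \<open>J a\<close>
  in a ball, a convex set, and segments there give curves of zero speed. Both directions are
  recorded, for points before and after a given parameter of a path.\<close>

lemma level_local:
  obtains d where "0 < d"
    "\<And>b. b \<in> ball a d \<Longrightarrow> F b = F a \<Longrightarrow> geod_dist G a b \<le> 0 \<and> geod_dist G b a \<le> 0"
proof -
  obtain U r g g' where g: "open U" "a \<in> U" "0 < r" "g 0 = a" "U \<subseteq> g ` ball 0 r"
    "\<And>y. y \<in> ball 0 r \<Longrightarrow> F (g y) = F a + J a y"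
    and dg: "\<And>y. y \<in> ball 0 r \<Longrightarrow> (g has_derivative g' y) (at y)"
      "\<And>v. continuous_on (ball 0 r) (\<lambda>y. g' y v)"
    by (rule straightening[of a]) blast
  obtain d where d: "0 < d" "ball a d \<subseteq> U" using g(1,2) by (meson open_contains_ball)
  have *: "geod_dist G (g y0) (g y1) \<le> 0"
    if y: "y0 \<in> ball 0 r" "y1 \<in> ball 0 r" "J a y0 = 0" "J a y1 = 0" for y0 y1
  proof (rule geod_dist_level_C1[OF C1_curve_line[OF convex_ball y(1,2) dg]])
    fix t :: real assume "t \<in> {0..1}"
    then have "(1 - t) *\<^sub>R y0 + t *\<^sub>R y1 \<in> ball 0 r"
      using y convex_ball[of "0::real^'d" r] by (simp add: convex_alt)
    then show "F (g ((1 - t) *\<^sub>R y0 + t *\<^sub>R y1)) = F (g y0)"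
      using y by (simp add: g(6) blinfun.bilinear_simps del: mem_ball)
  qed
  show thesis
  proof
    show "0 < d" by (rule d)
    fix b assume "b \<in> ball a d" and Fb: "F b = F a"
    then obtain y where y: "y \<in> ball 0 r" "b = g y" using d g(5) by blast
    then have "J a y = 0" using Fb g(6)[of y] by simp
    then show "geod_dist G a b \<le> 0 \<and> geod_dist G b a \<le> 0"
      using *[of 0 y] *[of y 0] y g(3,4) by simp
  qed
qed

text \<open>The chart sends the line spanned by \<open>v\<close> into the level set, and
  \<open>g' 0\<close> is the identity, so the image curve has velocity \<open>v\<close> at
  0.\<close>

lemma level_tangent:
  assumes "J a v = 0"
  obtains d \<eta> where "0 < d" "\<eta> 0 = a" "(\<eta> has_vector_derivative v) (at 0)"
    "\<And>t. \<bar>t\<bar> < d \<Longrightarrow> (a, \<eta> t) \<in> level_rel F"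
proof -
  obtain U r g g' where g: "0 < r" "g 0 = a" "\<And>y. y \<in> ball 0 r \<Longrightarrow> F (g y) = F a + J a y"
    and dg: "\<And>y. y \<in> ball 0 r \<Longrightarrow> (g has_derivative g' y) (at y)"
      "\<And>v. continuous_on (ball 0 r) (\<lambda>y. g' y v)" and g'0: "g' 0 = (\<lambda>v. v)"
    by (rule straightening[of a]) blast
  show thesis
  proof
    \<comment> \<open>Smaller parameters keep \<open>t\<close> times \<open>v\<close> in the ball of
      the chart; the added 1 covers \<open>v = 0\<close>.\<close>
    show "0 < r / (norm v + 1)" using g(1) by (intro divide_pos_pos) (auto simp: add_nonneg_pos)
    show "g (0 *\<^sub>R v) = a" by (simp add: g)
    have "((\<lambda>t. t *\<^sub>R v) has_derivative (\<lambda>t. t *\<^sub>R v)) (at 0)"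
      by (auto intro!: derivative_eq_intros)
    moreover have "(g has_derivative (\<lambda>v. v)) (at (0 *\<^sub>R v))"
      using dg(1)[of 0] g(1) g'0 by simp
    ultimately show "((\<lambda>t. g (t *\<^sub>R v)) has_vector_derivative v) (at 0)"
      unfolding has_vector_derivative_def by (rule has_derivative_compose)
    fix t :: real assume "\<bar>t\<bar> < r / (norm v + 1)"
    then have "\<bar>t\<bar> * (norm v + 1) < r" by (simp add: pos_less_divide_eq add_nonneg_pos)
    moreover have "\<bar>t\<bar> * norm v \<le> \<bar>t\<bar> * (norm v + 1)" by (intro mult_left_mono) auto
    ultimately have y: "t *\<^sub>R v \<in> ball 0 r" by simp
    have z: "0 \<in> ball (0::real^'d) r" using g(1) by simp
    have "(g 0, g (t *\<^sub>R v)) \<in> level_rel F"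
    proof (rule level_rel_C1[OF C1_curve_line[OF convex_ball z y dg]])
      fix s :: real assume "s \<in> {0..1}"
      then have "(1 - s) *\<^sub>R 0 + s *\<^sub>R (t *\<^sub>R v) \<in> ball 0 r"
        using convexD_alt[OF convex_ball z y, of s] by simp
      from g(3)[OF this] show "F (g ((1 - s) *\<^sub>R 0 + s *\<^sub>R (t *\<^sub>R v))) = F (g 0)"
        using assms by (simp add: g(2) blinfun.bilinear_simps)
    qed
    then show "(a, g (t *\<^sub>R v)) \<in> level_rel F" by (simp add: g(2))
  qed
qed

text \<open>Continuity of the path brings nearby parameters into the scope of
  \<open>level_local\<close>, and Bolzano bisection with the triangle inequality chains the local
  vanishing over the whole unit interval.\<close>

lemma geod_dist_level_rel:
  assumes "(a, b) \<in> level_rel F"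
  shows "geod_dist G a b \<le> 0"
proof -
  obtain \<gamma> where g: "\<gamma> piecewise_differentiable_on {0..1::real}" "\<gamma> 0 = a" "\<gamma> 1 = b"
    "\<And>t. t \<in> {0..1} \<Longrightarrow> F (\<gamma> t) = F a" using assms unfolding level_rel_def by blast
  have "0 \<le> (0::real) \<and> (1::real) \<le> 1 \<longrightarrow> geod_dist G (\<gamma> 0) (\<gamma> 1) \<le> 0"
  proof (rule Bolzano[where P = "\<lambda>x y. 0 \<le> x \<and> y \<le> 1 \<longrightarrow> geod_dist G (\<gamma> x) (\<gamma> y) \<le> 0"])
    fix x y z :: real
    assume xy: "0 \<le> x \<and> y \<le> 1 \<longrightarrow> geod_dist G (\<gamma> x) (\<gamma> y) \<le> 0"
      and yz: "0 \<le> y \<and> z \<le> 1 \<longrightarrow> geod_dist G (\<gamma> y) (\<gamma> z) \<le> 0" and "x \<le> y" "y \<le> z"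
    then show "0 \<le> x \<and> z \<le> 1 \<longrightarrow> geod_dist G (\<gamma> x) (\<gamma> z) \<le> 0"
      using geod_dist_triangle[of "\<gamma> x" "\<gamma> z" "\<gamma> y"] by auto
  next
    fix s :: real assume s: "0 \<le> s" "s \<le> 1"
    obtain d where d: "0 < d"
      "\<And>b. b \<in> ball (\<gamma> s) d \<Longrightarrow> F b = F (\<gamma> s) \<Longrightarrow> geod_dist G (\<gamma> s) b \<le> 0 \<and> geod_dist G b (\<gamma> s) \<le> 0"
      by (rule level_local[of "\<gamma> s"]) blast
    have "continuous_on {0..1} \<gamma>" using g(1) by (simp add: piecewise_differentiable_on_def)
    then obtain e where e: "0 < e" "\<And>t. t \<in> {0..1} \<Longrightarrow> dist t s < e \<Longrightarrow> dist (\<gamma> t) (\<gamma> s) < d"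
      using s d(1) unfolding continuous_on_iff by (metis atLeastAtMost_iff)
    have near: "geod_dist G (\<gamma> s) (\<gamma> t) \<le> 0 \<and> geod_dist G (\<gamma> t) (\<gamma> s) \<le> 0"
      if t: "t \<in> {0..1}" "dist t s < e" for t
    proof (rule d(2))
      show "\<gamma> t \<in> ball (\<gamma> s) d" using e(2)[OF t] by (simp add: dist_commute)
      show "F (\<gamma> t) = F (\<gamma> s)" using g(4)[OF t(1)] g(4)[of s] s by (metis atLeastAtMost_iff)
    qed
    show "\<exists>d>0. \<forall>x y. x \<le> s \<and> s \<le> y \<and> y - x < d \<longrightarrow>
        (0 \<le> x \<and> y \<le> 1 \<longrightarrow> geod_dist G (\<gamma> x) (\<gamma> y) \<le> 0)"
    proof (intro exI[of _ e] conjI allI impI e)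
      fix x y assume "x \<le> s \<and> s \<le> y \<and> y - x < e" "0 \<le> x \<and> y \<le> 1"
      then show "geod_dist G (\<gamma> x) (\<gamma> y) \<le> 0"
        using near[of x] near[of y] geod_dist_triangle[of "\<gamma> x" "\<gamma> y" "\<gamma> s"]
        by (simp add: dist_real_def)
    qed
  qed simp
  then show ?thesis by (simp add: g(2,3))
qed

section \<open>Two-sided comparison of the geodesic and quotient distances\<close>

lemma geod_dist_le_norm: "geod_dist G a b \<le> L * norm (a - b)"
proof -
  have "integral {0..1} (\<lambda>t. speed ((1 - t) *\<^sub>R a + t *\<^sub>R b) (b - a)) \<le> integral {0..1::real} (\<lambda>t. L * norm (b - a))"
    using speed_continuous[OF C1_curve_segment[of a b]]
    by (intro integral_le integrable_continuous_interval speed_upper) auto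
  then show ?thesis
    using geod_dist_le[OF C1_curve_segment[of a b]] by (simp add: norm_minus_commute)
qed

abbreviation level_dist :: "real^'d \<Rightarrow> real^'d \<Rightarrow> real" where
  "level_dist a b \<equiv> quot_dist (level_rel F) (level_rel F `` {a}) (level_rel F `` {b})"

lemma geod_dist_le_level_dist: "geod_dist G a b \<le> L * level_dist a b"
proof (rule field_le_epsilon)
  have "0 \<le> speed 0 1" by (rule speed_nonneg)
  also have "\<dots> \<le> L * norm (1 :: real^'d)" by (rule speed_upper)
  finally have L: "0 \<le> L" by (simp add: zero_le_mult_iff)
  fix e :: real assume e: "0 < e"
  \<comment> \<open>The margin \<open>e / (L + 1)\<close> stays meaningful for \<open>L = 0\<close>
    and costs at most \<open>e\<close> after multiplication by \<open>L\<close>.\<close>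
  obtain s where s: "quot_chain (level_rel F) (level_rel F `` {a}) (level_rel F `` {b}) s"
    "s < level_dist a b + e / (L + 1)"
    by (rule quot_dist_less[of "level_rel F" a b "level_dist a b + e / (L + 1)"])
      (use e L in auto)
  have "geod_dist G a b \<le> L * s"
    using equiv_level_rel[of F]
    by (intro quot_chain_sum_bound[OF s(1)] geod_dist_triangle geod_dist_level_rel geod_dist_le_norm)
      (simp_all add: equiv_def)
  also have "\<dots> \<le> L * (level_dist a b + e / (L + 1))" using s(2) L by (intro mult_left_mono) auto
  also have "\<dots> \<le> L * level_dist a b + e"
    using L e by (simp add: distrib_left pos_divide_le_eq mult.commute)
  finally show "geod_dist G a b \<le> L * level_dist a b + e" .
qed

text \<open>The point \<open>\<eta> (t - s)\<close> lies in the class of \<open>\<gamma> s\<close>,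
  so its Euclidean distance to \<open>\<gamma> t\<close> bounds the quotient distance. The
  difference of the two vanishes at \<open>s\<close> with velocity \<open>-u\<close>, and
  \<open>l * norm u\<close> is at most the speed.\<close>

lemma level_dist_first_order:
  assumes \<gamma>: "(\<gamma> has_vector_derivative v) (at s within S)" and e: "0 < e"
  obtains d where "0 < d" "\<And>t. t \<in> S \<Longrightarrow> \<bar>t - s\<bar> < d \<Longrightarrow>
    l * level_dist (\<gamma> s) (\<gamma> t) \<le> (speed (\<gamma> s) v + e) * \<bar>t - s\<bar> \<and>
    l * level_dist (\<gamma> t) (\<gamma> s) \<le> (speed (\<gamma> s) v + e) * \<bar>t - s\<bar>"
proof -
  \<comment> \<open>A short representative of \<open>v\<close> modulo the kernel, so that
    \<open>v - u\<close> is tangent to the fibre.\<close>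
  obtain u where u: "J (\<gamma> s) u = J (\<gamma> s) v" "l * norm u \<le> speed (\<gamma> s) v"
    using horizontal by blast
  obtain d1 \<eta> where d1: "0 < d1" and \<eta>: "\<eta> 0 = \<gamma> s" "(\<eta> has_vector_derivative v - u) (at 0)"
    "\<And>t. \<bar>t\<bar> < d1 \<Longrightarrow> (\<gamma> s, \<eta> t) \<in> level_rel F"
    by (rule level_tangent[of "\<gamma> s" "v - u"]) (auto simp: blinfun.bilinear_simps u(1))
  have "((\<lambda>t. t - s) has_derivative (\<lambda>t. t)) (at s within S)"
    by (auto intro!: derivative_eq_intros)
  moreover have "(\<eta> has_derivative (\<lambda>h. h *\<^sub>R (v - u))) (at (s - s))"
    using \<eta>(2) by (simp add: has_vector_derivative_def)
  ultimately have "((\<lambda>t. \<eta> (t - s)) has_derivative (\<lambda>h. h *\<^sub>R (v - u))) (at s within S)"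
    by (rule has_derivative_compose)
  then have "((\<lambda>t. \<eta> (t - s) - \<gamma> t) has_derivative (\<lambda>h. h *\<^sub>R (v - u) - h *\<^sub>R v)) (at s within S)"
    using \<gamma> unfolding has_vector_derivative_def by (rule has_derivative_diff)
  moreover have "0 < e / l" using e l_pos by simp
  ultimately obtain d2 where d2: "0 < d2" "\<And>t. t \<in> S \<Longrightarrow> norm (t - s) < d2 \<Longrightarrow>
     norm (\<eta> (t - s) - \<gamma> t - (\<eta> (s - s) - \<gamma> s) - ((t - s) *\<^sub>R (v - u) - (t - s) *\<^sub>R v)) \<le> e / l * norm (t - s)"
    unfolding has_derivative_within_alt by blast
  have bound: "l * norm (\<eta> (t - s) - \<gamma> t) \<le> (speed (\<gamma> s) v + e) * \<bar>t - s\<bar>"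
    if "t \<in> S" "\<bar>t - s\<bar> < d2" for t
  proof -
    have "norm ((\<eta> (t - s) - \<gamma> t) + (t - s) *\<^sub>R u) \<le> e / l * \<bar>t - s\<bar>"
      using d2(2)[of t] that by (simp add: \<eta>(1) algebra_simps)
    then have "norm (\<eta> (t - s) - \<gamma> t) \<le> norm u * \<bar>t - s\<bar> + e / l * \<bar>t - s\<bar>"
      using norm_triangle_ineq4[of "(\<eta> (t - s) - \<gamma> t) + (t - s) *\<^sub>R u" "(t - s) *\<^sub>R u"]
      by (simp add: mult.commute)
    then have "l * norm (\<eta> (t - s) - \<gamma> t) \<le> l * (norm u * \<bar>t - s\<bar> + e / l * \<bar>t - s\<bar>)"
      using l_pos by (intro mult_left_mono) auto
    also have "\<dots> = (l * norm u + e) * \<bar>t - s\<bar>" using l_pos by (simp add: field_simps)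
    also have "\<dots> \<le> (speed (\<gamma> s) v + e) * \<bar>t - s\<bar>" using u(2) by (intro mult_right_mono) auto
    finally show ?thesis .
  qed
  show thesis
  proof
    show "0 < min d1 d2" using d1 d2 by simp
    fix t assume t: "t \<in> S" "\<bar>t - s\<bar> < min d1 d2"
    have eq: "level_rel F `` {\<gamma> s} = level_rel F `` {\<eta> (t - s)}"
      using \<eta>(3)[of "t - s"] t(2) by (intro equiv_class_eq[OF equiv_level_rel]) simp
    have "l * level_dist (\<gamma> s) (\<gamma> t) \<le> l * norm (\<eta> (t - s) - \<gamma> t)"
      unfolding eq using l_pos by (intro mult_left_mono quot_dist_le_norm) auto
    moreover have "l * level_dist (\<gamma> t) (\<gamma> s) \<le> l * norm (\<gamma> t - \<eta> (t - s))"
      unfolding eq using l_pos by (intro mult_left_mono quot_dist_le_norm) auto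
    ultimately show "l * level_dist (\<gamma> s) (\<gamma> t) \<le> (speed (\<gamma> s) v + e) * \<bar>t - s\<bar> \<and>
      l * level_dist (\<gamma> t) (\<gamma> s) \<le> (speed (\<gamma> s) v + e) * \<bar>t - s\<bar>"
      using bound[of t] t by (simp add: norm_minus_commute)
  qed
qed

text \<open>The inequality with error \<open>e * (y - x)\<close> passes from adjacent intervals to
  their union and holds on short intervals around each parameter, so Bolzano bisection extends it to
  the unit interval.\<close>

lemma level_dist_le_length:
  assumes C1: "C1_curve \<gamma> \<gamma>' a b"
  shows "l * level_dist a b \<le> integral {0..1} (\<lambda>t. speed (\<gamma> t) (\<gamma>' t))"
proof (rule field_le_epsilon)
  fix e :: real assume e: "0 < e"
  define h where "h t = speed (\<gamma> t) (\<gamma>' t)" for t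
  have ch: "continuous_on {0..1} h" unfolding h_def by (rule speed_continuous[OF C1])
  have ih: "h integrable_on {x..y}" if "0 \<le> x" "y \<le> 1" for x y
    using that by (intro integrable_continuous_interval continuous_on_subset[OF ch]) auto
  define P where "P x y \<longleftrightarrow> (0 \<le> x \<and> y \<le> 1 \<longrightarrow>
    l * level_dist (\<gamma> x) (\<gamma> y) \<le> integral {x..y} h + e * (y - x))" for x y
  have triangle: "l * level_dist x z \<le> l * level_dist x y + l * level_dist y z" for x y z
    using mult_left_mono[OF quot_dist_triangle, of l "level_rel F" x z y] l_pos
    by (simp add: distrib_left)
  have "P 0 1"
  proof (rule Bolzano[of 0 1 P])
    fix x y z assume xyz: "P x y" "P y z" "x \<le> y" "y \<le> z"
    show "P x z" unfolding P_def
    proof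
      assume xz: "0 \<le> x \<and> z \<le> 1"
      then have "l * level_dist (\<gamma> x) (\<gamma> z) \<le> (integral {x..y} h + e * (y - x)) + (integral {y..z} h + e * (z - y))"
        using xyz triangle[of "\<gamma> x" "\<gamma> z" "\<gamma> y"] unfolding P_def by linarith
      also have "\<dots> = integral {x..z} h + e * (z - x)"
        using Henstock_Kurzweil_Integration.integral_combine[OF xyz(3,4) ih] xz by (simp add: algebra_simps)
      finally show "l * level_dist (\<gamma> x) (\<gamma> z) \<le> integral {x..z} h + e * (z - x)" .
    qed
  next
    fix s :: real assume s: "0 \<le> s" "s \<le> 1"
    have e2: "0 < e / 2" using e by simp
    have "(\<gamma> has_vector_derivative \<gamma>' s) (at s within {0..1})" using C1 s by (simp add: C1_curve_def)
    then obtain d1 where d1: "0 < d1" "\<And>t. t \<in> {0..1} \<Longrightarrow> \<bar>t - s\<bar> < d1 \<Longrightarrow>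
      l * level_dist (\<gamma> s) (\<gamma> t) \<le> (h s + e/2) * \<bar>t - s\<bar> \<and>
      l * level_dist (\<gamma> t) (\<gamma> s) \<le> (h s + e/2) * \<bar>t - s\<bar>"
      unfolding h_def by (rule level_dist_first_order[OF _ e2]) blast
    obtain d2 where d2: "0 < d2" "\<And>t. t \<in> {0..1} \<Longrightarrow> \<bar>t - s\<bar> < d2 \<Longrightarrow> \<bar>h t - h s\<bar> < e/2"
      using ch s e2 unfolding continuous_on_iff dist_real_def by (metis atLeastAtMost_iff)
    show "\<exists>d>0. \<forall>x y. x \<le> s \<and> s \<le> y \<and> y - x < d \<longrightarrow> P x y"
    proof (intro exI[of _ "min d1 d2"] conjI allI impI)
      show "0 < min d1 d2" using d1 d2 by simp
      fix x y assume A: "x \<le> s \<and> s \<le> y \<and> y - x < min d1 d2"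
      show "P x y" unfolding P_def
      proof
        assume B: "0 \<le> x \<and> y \<le> 1"
        have "l * level_dist (\<gamma> x) (\<gamma> s) \<le> (h s + e/2) * (s - x)"
          using d1(2)[of x] A B by simp
        moreover have "l * level_dist (\<gamma> s) (\<gamma> y) \<le> (h s + e/2) * (y - s)"
          using d1(2)[of y] A B by simp
        ultimately have "l * level_dist (\<gamma> x) (\<gamma> y) \<le> (h s + e/2) * (s - x) + (h s + e/2) * (y - s)"
          using triangle[of "\<gamma> x" "\<gamma> y" "\<gamma> s"] by linarith
        also have "\<dots> = (h s + e/2) * (y - x)" by (simp flip: distrib_left)
        finally have "l * level_dist (\<gamma> x) (\<gamma> y) \<le> (h s + e/2) * (y - x)" .
        \<comment> \<open>Near \<open>s\<close> the integrand is at least \<open>h s - e/2\<close>;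
          with the \<open>e/2\<close> of the first order estimate the total loss is \<open>e\<close>
          per unit of parameter.\<close>
        moreover have "integral {x..y} (\<lambda>t. h s - e/2) \<le> integral {x..y} h"
        proof (rule integral_le)
          fix t assume "t \<in> {x..y}"
          then have "t \<in> {0..1}" "\<bar>t - s\<bar> < d2" using A B by auto
          from d2(2)[OF this] show "h s - e/2 \<le> h t" by linarith
        qed (use ih B in auto)
        then have "(h s - e/2) * (y - x) \<le> integral {x..y} h" using A by (simp add: mult.commute)
        moreover have "(h s + e/2) * (y - x) = (h s - e/2) * (y - x) + e * (y - x)"
          by (simp flip: distrib_right)
        ultimately show "l * level_dist (\<gamma> x) (\<gamma> y) \<le> integral {x..y} h + e * (y - x)"
          by linarith
      qed
    qed
  qed simp
  moreover have "\<gamma> 0 = a" "\<gamma> 1 = b" using C1 by (simp_all add: C1_curve_def)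
  ultimately show "l * level_dist a b \<le> integral {0..1} (\<lambda>t. speed (\<gamma> t) (\<gamma>' t)) + e"
    by (simp add: P_def h_def[abs_def])
qed

lemma level_dist_le_geod_dist: "l * level_dist a b \<le> geod_dist G a b"
proof (rule field_le_epsilon)
  fix e :: real assume "0 < e"
  then have "geod_dist G a b < geod_dist G a b + e" by simp
  then obtain \<gamma> \<gamma>' where "C1_curve \<gamma> \<gamma>' a b"
    "integral {0..1} (\<lambda>t. speed (\<gamma> t) (\<gamma>' t)) < geod_dist G a b + e"
    by (rule geod_dist_less)
  with level_dist_le_length show "l * level_dist a b \<le> geod_dist G a b + e" by fastforce
qed

end

section \<open>The network\<close>

lemma continuous_on_matrix_matrix_mult [continuous_intros]:
  fixes A :: "'a::topological_space \<Rightarrow> real^'n^'m" and B :: "'a \<Rightarrow> real^'k^'n"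
  assumes "continuous_on S A" "continuous_on S B"
  shows "continuous_on S (\<lambda>x. A x ** B x)"
  unfolding matrix_matrix_mult_def using assms by (intro continuous_intros)

lemma continuous_on_transpose [continuous_intros]:
  fixes A :: "'a::topological_space \<Rightarrow> real^'n^'m"
  assumes "continuous_on S A"
  shows "continuous_on S (\<lambda>x. transpose (A x))"
  unfolding transpose_def using assms by (intro continuous_intros)

lemma inner_matrix_vector_transpose:
  fixes M :: "real^'n^'m"
  shows "(M *v x) \<bullet> y = x \<bullet> (transpose M *v y)"
  by (metis dot_lmul_matrix inner_commute transpose_matrix_vector)

section \<open>Bounds for a matrix from bounds on its Gram matrix\<close>

context
  notes transpose_matrix_vector [simp del]
  fixes M :: "real^'d^'m" and l L :: real
  assumes l: "0 < l"
    and bounds: "\<And>v. v \<noteq> 0 \<Longrightarrow> l \<le> norm ((M ** transpose M) *v v) / norm v \<and>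
      norm ((M ** transpose M) *v v) / norm v \<le> L"
begin

lemma gram_bounds:
  "l * norm v \<le> norm (M *v (transpose M *v v))" "norm (M *v (transpose M *v v)) \<le> L * norm v"
  using bounds[of v] by (cases "v = 0"; simp add: matrix_vector_mul_assoc field_simps)+

lemma norm_transpose_square: "(norm (transpose M *v u))\<^sup>2 = u \<bullet> (M *v (transpose M *v u))"
  by (simp add: power2_norm_eq_inner inner_matrix_vector_transpose)

text \<open>The upper Gram bound controls \<open>transpose M\<close> through
  \<open>|M^T u|^2 = u . M M^T u\<close>; duality with \<open>u = M x\<close> carries the bound over
  to \<open>M\<close>.\<close>

lemma norm_le_of_gram_upper: "norm (M *v x) \<le> sqrt L * norm x"
proof -
  define u where "u = M *v x"
  have "(norm (transpose M *v u))\<^sup>2 \<le> norm u * norm (M *v (transpose M *v u))"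
    unfolding norm_transpose_square by (rule norm_cauchy_schwarz)
  also have "\<dots> \<le> norm u * (L * norm u)" by (intro mult_left_mono gram_bounds) auto
  finally have "(norm (transpose M *v u))\<^sup>2 \<le> L * (norm u)\<^sup>2" by (simp add: power2_eq_square mult_ac)
  from real_sqrt_le_mono[OF this] have t: "norm (transpose M *v u) \<le> sqrt L * norm u"
    by (simp add: real_sqrt_mult)
  have "norm u * norm u = x \<bullet> (transpose M *v u)"
    using inner_matrix_vector_transpose[of M x u] by (simp add: u_def dot_square_norm power2_eq_square)
  also have "\<dots> \<le> norm x * (sqrt L * norm u)"
    by (intro order_trans[OF norm_cauchy_schwarz] mult_left_mono t) auto
  finally have "norm u * norm u \<le> (sqrt L * norm x) * norm u" by (simp add: mult_ac)
  moreover have "0 \<le> L" using bounds[of 1] l by auto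
  ultimately show ?thesis
    by (cases "u = 0") (auto simp: u_def dest: mult_right_le_imp_le)
qed

text \<open>The lower Gram bound makes the square matrix \<open>M ** transpose M\<close> injective,
  hence surjective.\<close>

lemma gram_preimage: "\<exists>v. M *v (transpose M *v v) = y"
proof -
  have "v = 0" if "(M ** transpose M) *v v = 0" for v
    using gram_bounds(1)[of v] l that by (simp add: mult_le_0_iff flip: matrix_vector_mul_assoc)
  then have "inj ((*v) (M ** transpose M))"
    by (subst linear_injective_0[OF matrix_vector_mul_linear]) blast
  then have "surj ((*v) (M ** transpose M))"
    by (intro linear_injective_imp_surjective matrix_vector_mul_linear refl)
  then show ?thesis by (metis matrix_vector_mul_assoc surjD)
qed

text \<open>The preimage under \<open>M\<close> that is orthogonal to its kernel.\<close>

lemma gram_horizontal: "\<exists>u. M *v u = M *v x \<and> sqrt l * norm u \<le> norm (M *v x)"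
proof -
  obtain v where v: "M *v (transpose M *v v) = M *v x" using gram_preimage by blast
  define u where "u = transpose M *v v"
  have Mu: "M *v u = M *v x" by (simp add: u_def v)
  \<comment> \<open>Here \<open>|u|^2 = v . M x\<close> by the choice of \<open>v\<close>, and
    \<open>l |v| \<le> |M x|\<close> by the lower Gram bound.\<close>
  have "l * (norm u)\<^sup>2 \<le> l * (norm v * norm (M *v x))"
    unfolding u_def norm_transpose_square v using l by (intro mult_left_mono norm_cauchy_schwarz) auto
  also have "\<dots> = (l * norm v) * norm (M *v x)" by simp
  also have "\<dots> \<le> norm (M *v x) * norm (M *v x)"
    using gram_bounds(1)[of v] v by (intro mult_right_mono) auto
  finally have "l * (norm u)\<^sup>2 \<le> (norm (M *v x))\<^sup>2" by (simp add: power2_eq_square)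
  from real_sqrt_le_mono[OF this] have "sqrt l * norm u \<le> norm (M *v x)"
    by (simp add: real_sqrt_mult)
  then show ?thesis using Mu by blast
qed

end

section \<open>The block-diagonal Hessian and the stacked network map\<close>

lemma H_block_mult:
  "(H_block f H X w *v v) $ (k, a) = (H (f w (X k)) *v (\<chi> b. v $ (k, b))) $ a"
proof -
  have "(H_block f H X w *v v) $ (k, a) =
      (\<Sum>j\<in>UNIV. \<Sum>b\<in>UNIV. (if k = j then H (f w (X k)) $ a $ b else 0) * v $ (j, b))"
    unfolding sum.cartesian_product UNIV_Times_UNIV
    by (auto simp: H_block_def matrix_vector_mult_def split_def intro!: sum.cong)
  also have "\<dots> = (\<Sum>j\<in>UNIV. if k = j then \<Sum>b\<in>UNIV. H (f w (X k)) $ a $ b * v $ (j, b) else 0)"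
    by (intro sum.cong) auto
  also have "\<dots> = (\<Sum>b\<in>UNIV. H (f w (X k)) $ a $ b * v $ (k, b))" by simp
  finally show ?thesis by (simp add: matrix_vector_mult_def)
qed

lemma H_block_inner:
  "v \<bullet> (H_block f H X w *v v) =
    (\<Sum>k\<in>UNIV. (\<chi> b. v $ (k, b)) \<bullet> (H (f w (X k)) *v (\<chi> b. v $ (k, b))))"
proof -
  have "v \<bullet> (H_block f H X w *v v) = (\<Sum>(k, a)\<in>UNIV. v $ (k, a) * (H_block f H X w *v v) $ (k, a))"
    by (simp add: inner_vec_def split_def)
  also have "\<dots> = (\<Sum>k\<in>UNIV. \<Sum>a\<in>UNIV. v $ (k, a) * (H_block f H X w *v v) $ (k, a))"
    by (simp add: sum.cartesian_product)
  finally show ?thesis by (simp add: inner_vec_def H_block_mult)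
qed

text \<open>A nonzero vector has a nonzero block, whose term in the quadratic form is positive while
  the others are nonnegative.\<close>

lemma pos_def_H_block:
  assumes "\<And>z. pos_def (H z)"
  shows "pos_def (H_block f H X w)"
proof -
  have "H z $ a $ b = H z $ b $ a" for z a b
  proof -
    have "transpose (H z) $ b $ a = H z $ b $ a" using assms[of z] by (simp add: pos_def_def)
    then show ?thesis by (simp add: transpose_def)
  qed
  then have "transpose (H_block f H X w) = H_block f H X w"
    by (simp add: vec_eq_iff transpose_def H_block_def)
  moreover have "0 < v \<bullet> (H_block f H X w *v v)" if nz: "v \<noteq> 0" for v
  proof -
    obtain k a where ka: "v $ (k, a) \<noteq> 0" using nz by (auto simp: vec_eq_iff)
    have nn: "0 \<le> u \<bullet> (H z *v u)" for u z
      using assms[of z] by (cases "u = 0") (auto simp: pos_def_def less_imp_le)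
    have "(\<chi> b. v $ (k, b)) \<noteq> 0" using ka by (auto simp: vec_eq_iff)
    then have "0 < (\<chi> b. v $ (k, b)) \<bullet> (H (f w (X k)) *v (\<chi> b. v $ (k, b)))"
      using assms by (simp add: pos_def_def)
    then show ?thesis unfolding H_block_inner by (intro sum_pos2[of UNIV k] nn) auto
  qed
  ultimately show ?thesis by (simp add: pos_def_def)
qed

text \<open>One map whose level sets are the joint fibres over all data points and whose derivative
  is \<open>J_stack\<close>.\<close>

definition stacked_output :: "(real^'d \<Rightarrow> real^'i \<Rightarrow> real^'o) \<Rightarrow> ('n \<Rightarrow> real^'i) \<Rightarrow> real^'d
    \<Rightarrow> real^('n::finite \<times> 'o::finite)" where
  "stacked_output f X w = (\<chi> r. f w (X (fst r)) $ snd r)"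

lemma fiber_rel_eq_level_rel: "fiber_rel f X = level_rel (stacked_output f X)"
  by (simp add: fiber_rel_def level_rel_def stacked_output_def vec_eq_iff)

lemma stacked_output_has_derivative:
  assumes "\<And>x. (\<lambda>v. f v x) differentiable (at w)"
  shows "(stacked_output f X has_derivative (*v) (J_stack f X w)) (at w)"
proof -
  have "((\<lambda>v. f v x $ a) has_derivative (\<lambda>h. (Jac f w x *v h) $ a)) (at w)" for x a
    using assms[of x] unfolding jacobian_works Jac_def[symmetric]
    by (rule bounded_linear.has_derivative[OF bounded_linear_vec_nth])
  then show ?thesis
    by (subst has_derivative_componentwise_within)
      (auto simp: Basis_vec_def inner_axis stacked_output_def J_stack_def matrix_vector_mult_def)
qed

theorem theorem4p5:
  fixes f :: "real^'d \<Rightarrow> real^'i \<Rightarrow> real^'o"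
    and X :: "'n::finite \<Rightarrow> real^'i"
    and \<nu> :: "'y measure"
    and p :: "'y \<Rightarrow> real^'o \<Rightarrow> real"
    and H :: "real^'o \<Rightarrow> real^'o^'o"
    and l L \<epsilon> :: real
    and w0 w1 :: "real^'d"
  assumes f_diff: "\<And>w x. (\<lambda>v. f v x) differentiable (at w)"
    and f_C1: "\<And>x. continuous_on UNIV (\<lambda>w. Jac f w x)"
    and likelihood: "is_likelihood \<nu> p"
    and hessian: "\<And>y. y \<in> space \<nu> \<Longrightarrow> has_hessian (\<lambda>z. - ln (p y z)) H"
    and H_cont: "continuous_on UNIV H"
    and H_pos: "\<And>z. pos_def (H z)"
    and l_L: "0 < l" "l \<le> L"
    and NTK_bounds: "\<And>w v. v \<noteq> 0 \<Longrightarrow>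
      l \<le> norm (NTK f H X w *v v) / norm v \<and> norm (NTK f H X w *v v) / norm v \<le> L"
    and J_lipschitz: "\<And>k. \<exists>C. C-lipschitz_on UNIV (\<lambda>w. Jac f w (X k))"
    and eps: "\<epsilon> > 0"
  shows "\<exists>\<delta>>0.
    (quot_dist (fiber_rel f X) (fiber_rel f X `` {w0}) (fiber_rel f X `` {w1}) < \<delta>
      \<longrightarrow> geod_dist (GGN f H X) w0 w1 < \<epsilon>) \<and>
    (geod_dist (GGN f H X) w0 w1 < \<delta>
      \<longrightarrow> quot_dist (fiber_rel f X) (fiber_rel f X `` {w0}) (fiber_rel f X `` {w1}) < \<epsilon>)"
proof -
  define S where "S w = matrix_sqrt (H_block f H X w)" for w
  define M where "M w = S w ** J_stack f X w" for w
  have pd: "pos_def (S w)" and SS: "S w ** S w = H_block f H X w" for w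
    unfolding S_def by (rule matrix_sqrt_pos_def pos_def_H_block H_pos)+
  have tS: "transpose (S w) = S w" for w using pd by (simp add: pos_def_def)
  \<comment> \<open>Injectivity of \<open>S w\<close> lets statements about \<open>M w\<close> be
    read as statements about the stacked Jacobian.\<close>
  have S_cancel: "u = v" if "S w *v u = S w *v v" for w u v
  proof -
    have "(u - v) \<bullet> (S w *v (u - v)) = 0" using that by (simp add: matrix_vector_mult_diff_distrib)
    then show ?thesis using pd[of w] unfolding pos_def_def by (metis less_irrefl right_minus_eq)
  qed
  have NTK_eq: "NTK f H X w = M w ** transpose (M w)" for w
    by (simp add: NTK_def M_def matrix_transpose_mul tS matrix_mul_assoc flip: S_def)
  have GGN_eq: "GGN f H X w = transpose (M w) ** M w" for w
    by (simp add: GGN_def M_def matrix_transpose_mul tS matrix_mul_assoc flip: SS)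
  have GGN_inner: "v \<bullet> (GGN f H X w *v v) = (norm (M w *v v))\<^sup>2" for w v
    by (simp add: GGN_eq power2_norm_eq_inner inner_matrix_vector_transpose flip: matrix_vector_mul_assoc)
  have gram: "v \<noteq> 0 \<Longrightarrow> l \<le> norm ((M w ** transpose (M w)) *v v) / norm v \<and>
      norm ((M w ** transpose (M w)) *v v) / norm v \<le> L" for w v
    by (rule NTK_bounds[of v w, unfolded NTK_eq])
  have cJ: "continuous_on UNIV (J_stack f X)"
    unfolding J_stack_def by (intro continuous_intros f_C1)
  have cf: "continuous_on UNIV (\<lambda>w. f w x)" for x
    using f_diff by (meson continuous_at_imp_continuous_on differentiable_imp_continuous_within)
  \<comment> \<open>\<open>c\<close> stands for the block test, which does not depend on
    \<open>w\<close>.\<close>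
  have "continuous_on UNIV (\<lambda>w. if c then H (f w x) $ a $ b else 0)" for c a b x
    by (cases c) (auto intro!: continuous_intros continuous_on_compose2[OF H_cont] cf)
  then have cH: "continuous_on UNIV (H_block f H X)"
    unfolding H_block_def by (intro continuous_intros)
  interpret metric_field "GGN f H X"
  proof
    show "continuous_on UNIV (GGN f H X)" unfolding GGN_def by (intro continuous_intros cJ cH)
  qed (simp add: GGN_inner)
  have speed_eq: "speed w v = norm (M w *v v)" for w v by (simp add: speed_def GGN_inner)
  define J where "J w = Blinfun ((*v) (J_stack f X w))" for w
  have J: "blinfun_apply (J w) = (*v) (J_stack f X w)" for w
    by (simp add: J_def bounded_linear_Blinfun_apply matrix_vector_mul_bounded_linear)
  have M: "M w *v v = S w *v J w v" for w v by (simp add: M_def J matrix_vector_mul_assoc)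
  \<comment> \<open>The NTK bounds control squares of speeds, hence the square roots.\<close>
  interpret submersion_metric "GGN f H X" "stacked_output f X" J "sqrt l" "sqrt L"
  proof
    show "(stacked_output f X has_derivative J w) (at w)" for w
      unfolding J by (rule stacked_output_has_derivative[OF f_diff])
    show "continuous_on UNIV J"
      by (rule continuous_on_blinfun_componentwise) (simp add: J, intro continuous_intros cJ)
    show "surj (J w)" for w
    proof (rule surjI)
      \<comment> \<open>With \<open>x\<close> the image of \<open>v\<close> under
        \<open>transpose (M w)\<close>, one has \<open>M w *v x = S w *v y\<close>, and cancelling
        \<open>S w\<close> gives \<open>J w x = y\<close>.\<close>
      fix y
      have "\<exists>v. M w *v (transpose (M w) *v v) = S w *v y"
        by (rule gram_preimage[OF l_L(1) gram])
      then have "\<exists>x. J w x = y" using S_cancel unfolding M by blast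
      then show "J w (SOME x. J w x = y) = y" by (rule someI_ex)
    qed
    show "0 < sqrt l" using l_L by simp
    show "speed w v = 0" if "J w v = 0" for w v using that by (simp add: speed_eq M)
    show "speed w v \<le> sqrt L * norm v" for w v
      unfolding speed_eq by (rule norm_le_of_gram_upper[OF l_L(1) gram])
    show "\<exists>u. J w u = J w v \<and> sqrt l * norm u \<le> speed w v" for w v
      using gram_horizontal[OF l_L(1) gram, of w v] S_cancel unfolding speed_eq M by blast
  qed
  let ?D = "quot_dist (fiber_rel f X) (fiber_rel f X `` {w0}) (fiber_rel f X `` {w1})"
  have D: "geod_dist (GGN f H X) w0 w1 \<le> sqrt L * ?D" "sqrt l * ?D \<le> geod_dist (GGN f H X) w0 w1"
    unfolding fiber_rel_eq_level_rel by (rule geod_dist_le_level_dist level_dist_le_geod_dist)+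
  have pos: "0 < sqrt l" "0 < sqrt L" using l_L by auto
  show ?thesis
  \<comment> \<open>The two components serve the two implications; they depend only on
    \<open>\<epsilon>\<close>, \<open>l\<close> and \<open>L\<close>, not on the points.\<close>
  proof (intro exI[of _ "min (\<epsilon> / sqrt L) (sqrt l * \<epsilon>)"] conjI impI)
    show "0 < min (\<epsilon> / sqrt L) (sqrt l * \<epsilon>)" using eps pos by simp
  next
    assume "?D < min (\<epsilon> / sqrt L) (sqrt l * \<epsilon>)"
    then have "sqrt L * ?D < \<epsilon>" using pos by (simp add: pos_less_divide_eq mult.commute)
    then show "geod_dist (GGN f H X) w0 w1 < \<epsilon>" using D(1) by linarith
  next
    assume "geod_dist (GGN f H X) w0 w1 < min (\<epsilon> / sqrt L) (sqrt l * \<epsilon>)"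
    then have "sqrt l * ?D < sqrt l * \<epsilon>" using D(2) by linarith
    then show "?D < \<epsilon>" using pos by simp
  qed
qed

end
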